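(* There exist a universal constant $C>0$ and an integer $n_0$ such that for every integer $n>n_0$ and every integer $t$ with $n-2\le t\le \frac{n^2}{2}-Cn\log n$, there exists an $(n,t)$-blocker, i.e. a saturated blocker for triangulations of a convex $n$-gon consisting of exactly $t$ edges.
   Context: Let $P$ be a convex polygon with $n$ vertices labeled $0,1,\dots,n-1$ in cyclic order (indices modulo $n$). An edge $(i,j)$ is the segment between vertices $i$ and $j$; boundary edges are $(i,i+1)$, and diagonals are the other edges. Two edges cross if they share an interior point. A triangulation of $P$ is a maximal set of pairwise non-crossing diagonals of $P$. A blocker (for triangulations) is a set $B$ of diagonals having at least one diagonal in common with every triangulation of $P$. A blocker $B$ is saturated if for every $e\in B$ the set $B\setminus\{e\}$ is not a blocker. An $(n,k)$-blocker is a saturated blocker of size $k$ for a convex $n$-gon. *)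

theory Defs
  imports Complex_Main
begin

text \<open>Vertices of the convex n-gon are 0,...,n-1 in cyclic order. An edge is
represented as a pair (i,j) with i < j (the segment between vertices i and j).\<close>

definition is_diagonal :: "nat \<Rightarrow> nat \<times> nat \<Rightarrow> bool" where
  "is_diagonal n e \<longleftrightarrow> (case e of (i, j) \<Rightarrow>
      i < j \<and> j < n \<and> j \<noteq> i + 1 \<and> \<not> (i = 0 \<and> j = n - 1))"

definition diagonals :: "nat \<Rightarrow> (nat \<times> nat) set" where
  "diagonals n = {e. is_diagonal n e}"

text \<open>Two chords of a convex polygon share an interior point iff their endpoints
strictly interleave in the cyclic order.\<close>
definition crosses :: "nat \<times> nat \<Rightarrow> nat \<times> nat \<Rightarrow> bool" where
  "crosses e f \<longleftrightarrow> (case e of (i, j) \<Rightarrow> case f of (k, l) \<Rightarrow>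
      (i < k \<and> k < j \<and> j < l) \<or> (k < i \<and> i < l \<and> l < j))"

definition non_crossing :: "(nat \<times> nat) set \<Rightarrow> bool" where
  "non_crossing S \<longleftrightarrow> (\<forall>e\<in>S. \<forall>f\<in>S. \<not> crosses e f)"

definition triangulation :: "nat \<Rightarrow> (nat \<times> nat) set \<Rightarrow> bool" where
  "triangulation n T \<longleftrightarrow> T \<subseteq> diagonals n \<and> non_crossing T \<and>
     (\<forall>T'. T \<subseteq> T' \<and> T' \<subseteq> diagonals n \<and> non_crossing T' \<longrightarrow> T' = T)"

definition blocker :: "nat \<Rightarrow> (nat \<times> nat) set \<Rightarrow> bool" where
  "blocker n B \<longleftrightarrow> B \<subseteq> diagonals n \<and> (\<forall>T. triangulation n T \<longrightarrow> B \<inter> T \<noteq> {})"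

definition saturated_blocker :: "nat \<Rightarrow> (nat \<times> nat) set \<Rightarrow> bool" where
  "saturated_blocker n B \<longleftrightarrow> blocker n B \<and> (\<forall>e\<in>B. \<not> blocker n (B - {e}))"

definition nk_blocker :: "nat \<Rightarrow> nat \<Rightarrow> (nat \<times> nat) set \<Rightarrow> bool" where
  "nk_blocker n k B \<longleftrightarrow> saturated_blocker n B \<and> finite B \<and> card B = k"

end

theory Submission
  imports Defs
begin

text \<open>
A set \<^term>\<open>B\<close> of diagonals is a saturated blocker as soon as the chords outside \<^term>\<open>B\<close>,
together with the boundary edges, can be oriented consistently: \<^term>\<open>g i j\<close> says that the part
of the polygon met when walking clockwise from \<^term>\<open>i\<close> to \<^term>\<open>j\<close> can be triangulated without
\<^term>\<open>B\<close>, chord included. No clockwise triangle may be a directed cycle (so there is no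
triangulation avoiding \<^term>\<open>B\<close>), and each side of a chord of \<^term>\<open>B\<close> must have an apex
joined to it by two arcs (so that chord alone can be added).

A hub joined to almost all vertices gives blockers with up to about $n^2/4$ edges. Its first sources
form a block of consecutive vertices that look alike from outside and are pairwise joined. Six
vertices of such a block can be rewired so that the rest splits into two blocks of the same kind
with all chords between them in the blocker. Doing this to depth about $\log_2 n$, with halves of
equal size, leaves only $O(n \log n)$ chords outside the blocker. Moving a vertex from the
unstructured part of the hub configuration into the block increases the size by at most the range
of one free parameter, so every intermediate size occurs.
\<close>

section \<open>Oriented chords and saturated blockers\<close>

text \<open>Strict clockwise order: walking clockwise from \<open>i\<close>, the vertex
  \<open>k\<close> is met before \<open>j\<close>. The three disjuncts are the three places where
  the cycle \<open>i\<close>, \<open>k\<close>, \<open>j\<close> may wrap around.\<close>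

definition between :: "nat \<Rightarrow> nat \<Rightarrow> nat \<Rightarrow> bool" where
  "between i k j \<longleftrightarrow> i < k \<and> k < j \<or> k < j \<and> j < i \<or> j < i \<and> i < k"

definition nxt :: "nat \<Rightarrow> nat \<Rightarrow> nat" where
  "nxt n i = (if Suc i = n then 0 else Suc i)"

text \<open>The last clause packs two demands. For an arc from \<open>i\<close> to \<open>j\<close>
  that is not a side, antisymmetry excludes \<open>g j i\<close> and leaves an apex on the clockwise
  side. An unoriented chord meets the clause in both directions and so gets an apex on each
  side.\<close>

definition orientation :: "nat \<Rightarrow> (nat \<Rightarrow> nat \<Rightarrow> bool) \<Rightarrow> bool" where
  "orientation n g \<longleftrightarrow>
     (\<forall>i<n. g i (nxt n i)) \<and>
     (\<forall>i<n. \<forall>j<n. g i j \<longrightarrow> \<not> g j i) \<and>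
     (\<forall>i<n. \<forall>j<n. \<forall>k<n. g i j \<and> g j k \<and> g k i \<longrightarrow> \<not> between i j k) \<and>
     (\<forall>i<n. \<forall>j<n. i \<noteq> j \<and> j \<noteq> nxt n i \<longrightarrow>
        g j i \<or> (\<exists>k<n. between i k j \<and> g i k \<and> g k j))"

definition unoriented :: "nat \<Rightarrow> (nat \<Rightarrow> nat \<Rightarrow> bool) \<Rightarrow> (nat \<times> nat) set" where
  "unoriented n g = {(i, j). i < j \<and> j < n \<and> \<not> g i j \<and> \<not> g j i}"

section \<open>Triangulations of a subpolygon, built by gluing along chords\<close>

inductive triangulates :: "nat \<Rightarrow> nat \<Rightarrow> (nat \<times> nat) set \<Rightarrow> bool" where
  side: "triangulates i (Suc i) {(i, Suc i)}"
| glue: "triangulates i k S \<Longrightarrow> triangulates k j S' \<Longrightarrow> triangulates i j (insert (i, j) (S \<union> S'))"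

lemma triangulates_less: "triangulates i j S \<Longrightarrow> i < j"
  by (induction rule: triangulates.induct) auto

lemma triangulates_root: "triangulates i j S \<Longrightarrow> (i, j) \<in> S"
  by (induction rule: triangulates.induct) auto

lemma triangulates_range:
  "triangulates i j S \<Longrightarrow> (a, b) \<in> S \<Longrightarrow> i \<le> a \<and> a < b \<and> b \<le> j"
proof (induction arbitrary: a b rule: triangulates.induct)
  case (glue i k S j S')
  then show ?case using triangulates_less[OF glue.hyps(1)] triangulates_less[OF glue.hyps(2)]
    by fastforce
qed auto

text \<open>Chords from the two parts of a gluing lie in \<open>i..k\<close> and in
  \<open>k..j\<close>, which share only the vertex \<open>k\<close>; the root \<open>(i, j)\<close>
  spans them all.\<close>

lemma triangulates_non_crossing:
  "triangulates i j S \<Longrightarrow> e \<in> S \<Longrightarrow> f \<in> S \<Longrightarrow> \<not> crosses e f"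
proof (induction arbitrary: e f rule: triangulates.induct)
  case (side i)
  then show ?case by (auto simp: crosses_def)
next
  case (glue i k S j S')
  obtain a b c d where e: "e = (a, b)" and f: "f = (c, d)" by (cases e; cases f) auto
  note r1 = triangulates_range[OF glue.hyps(1)] and r2 = triangulates_range[OF glue.hyps(2)]
  have R: "i \<le> u \<and> u < v \<and> v \<le> j" if "(u, v) \<in> insert (i, j) (S \<union> S')" for u v
    using triangulates_range[OF triangulates.glue[OF glue.hyps]] that by blast
  consider "e = (i, j)" | "f = (i, j)" | "e \<in> S" "f \<in> S" | "e \<in> S'" "f \<in> S'"
    | "e \<in> S" "f \<in> S'" | "e \<in> S'" "f \<in> S"
    using glue.prems by blast
  then show ?case
  proof cases
    case 1
    then show ?thesis using R[of c d] glue.prems(2) f by (auto simp: crosses_def)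
  next
    case 2
    then show ?thesis using R[of a b] glue.prems(1) e by (auto simp: crosses_def)
  next
    case 3
    then show ?thesis using glue.IH(1) by blast
  next
    case 4
    then show ?thesis using glue.IH(2) by blast
  next
    case 5
    then show ?thesis using r1[of a b] r2[of c d] e f by (auto simp: crosses_def)
  next
    case 6
    then show ?thesis using r2[of a b] r1[of c d] e f by (auto simp: crosses_def)
  qed
qed

text \<open>A chord other than the root with \<open>k\<close> strictly between its ends has an end
  strictly inside \<open>i..j\<close>, hence crosses \<open>(i, k)\<close> or \<open>(k, j)\<close>.
  Every other chord but the root falls into one of the two parts.\<close>

lemma triangulates_maximal:
  "triangulates i j S \<Longrightarrow> i \<le> a \<Longrightarrow> a < b \<Longrightarrow> b \<le> j \<Longrightarrow> \<forall>e\<in>S. \<not> crosses e (a, b) \<Longrightarrow> (a, b) \<in> S"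
proof (induction arbitrary: a b rule: triangulates.induct)
  case (side i)
  then show ?case by auto
next
  case (glue i k S j S')
  have ik: "(i, k) \<in> S" and kj: "(k, j) \<in> S'"
    using glue.hyps by (auto intro: triangulates_root)
  have "\<not> crosses (i, k) (a, b)" "\<not> crosses (k, j) (a, b)"
    using ik kj glue.prems(4) by blast+
  then have "a = i \<and> b = j \<or> b \<le> k \<or> k \<le> a"
    using glue.prems(1-3) by (auto simp: crosses_def)
  then consider "a = i" "b = j" | "b \<le> k" | "k \<le> a" by blast
  then show ?case
    using glue.IH glue.prems by cases auto
qed

text \<open>The set \<open>S\<close> also holds the sides of the polygon and the closing edge
  \<open>(0, n - 1)\<close>, which keeps gluing uniform. Intersecting with
  \<open>diagonals n\<close> removes them; as they never cross a diagonal, maximality carries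
  over.\<close>

lemma triangulation_of_triangulates:
  assumes S: "triangulates 0 (n - 1) S"
  shows "triangulation n (S \<inter> diagonals n)"
proof -
  have n: "0 < n - 1" using triangulates_less[OF S] .
  have "T' = S \<inter> diagonals n"
    if T': "S \<inter> diagonals n \<subseteq> T'" "T' \<subseteq> diagonals n" "non_crossing T'" for T'
  proof
    show "T' \<subseteq> S \<inter> diagonals n"
    proof
      fix f assume f: "f \<in> T'"
      obtain a b where ab: "f = (a, b)" by (cases f)
      have dg: "is_diagonal n (a, b)" using f T'(2) ab by (auto simp: diagonals_def)
      have "\<not> crosses e (a, b)" if e: "e \<in> S" for e
      proof (cases "e \<in> diagonals n")
        case True
        then show ?thesis using e f T'(1,3) ab by (auto simp: non_crossing_def)
      next
        case False
        obtain c d where cd: "e = (c, d)" by (cases e)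
        have "c < d" "d \<le> n - 1" using triangulates_range[OF S] e cd by auto
        then show ?thesis using False dg n cd by (auto simp: diagonals_def is_diagonal_def crosses_def)
      qed
      then have "(a, b) \<in> S"
        using triangulates_maximal[OF S, of a b] dg by (auto simp: is_diagonal_def)
      then show "f \<in> S \<inter> diagonals n" using f T'(2) ab by auto
    qed
  qed (use T' in auto)
  moreover have "non_crossing (S \<inter> diagonals n)"
    using triangulates_non_crossing[OF S] by (auto simp: non_crossing_def)
  ultimately show ?thesis by (auto simp: triangulation_def)
qed

text \<open>This finds the triangle on the inner side of an edge of \<open>T\<close>. Its apex is
  the last vertex before \<open>j\<close> that is joined to \<open>i\<close>. The implications from
  \<open>is_diagonal\<close> let sides of the polygon count as edges.\<close>

lemma triangulation_apex:
  assumes T: "triangulation n T" and ij: "i < j" "j < n" "j \<noteq> Suc i"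
    and e: "is_diagonal n (i, j) \<longrightarrow> (i, j) \<in> T"
  shows "\<exists>k. i < k \<and> k < j \<and> (is_diagonal n (i, k) \<longrightarrow> (i, k) \<in> T) \<and> (is_diagonal n (k, j) \<longrightarrow> (k, j) \<in> T)"
proof -
  define K where "K = {k. i < k \<and> k < j \<and> (is_diagonal n (i, k) \<longrightarrow> (i, k) \<in> T)}"
  define k where "k = Max K"
  have finK: "finite K" by (rule finite_subset[of _ "{..<j}"]) (auto simp: K_def)
  have "Suc i \<in> K" using ij by (auto simp: K_def is_diagonal_def)
  then have kK: "k \<in> K" unfolding k_def using Max_in[OF finK] by blast
  have kmax: "r \<le> k" if "r \<in> K" for r unfolding k_def using finK that by (rule Max_ge)
  have Td: "T \<subseteq> diagonals n" and nc: "non_crossing T" using T by (auto simp: triangulation_def)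
  have "(k, j) \<in> T" if dg: "is_diagonal n (k, j)"
  proof (rule ccontr)
    assume "(k, j) \<notin> T"
    then have "\<not> non_crossing (insert (k, j) T)"
      using T dg by (auto simp: triangulation_def diagonals_def)
    moreover have "\<not> crosses (k, j) (k, j)" by (auto simp: crosses_def)
    ultimately obtain f where f: "f \<in> T" "crosses (k, j) f \<or> crosses f (k, j)"
      using nc by (auto simp: non_crossing_def)
    obtain p r where pr: "f = (p, r)" by (cases f)
    have prd: "is_diagonal n (p, r)" using f(1) Td pr by (auto simp: diagonals_def)
    \<comment> \<open>A chord of \<open>T\<close> crossing \<open>(k, j)\<close> crosses neither
      \<open>(i, j)\<close> nor \<open>(i, k)\<close>, so it starts at \<open>i\<close> and ends
      beyond \<open>k\<close>, against the choice of \<open>k\<close>.\<close>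
    have "\<not> crosses (i, j) (p, r)"
    proof (cases "is_diagonal n (i, j)")
      case True
      then show ?thesis using e nc f(1) pr by (auto simp: non_crossing_def)
    next
      case False
      then show ?thesis using ij prd by (auto simp: is_diagonal_def crosses_def)
    qed
    moreover have "\<not> crosses (i, k) (p, r)"
    proof (cases "is_diagonal n (i, k)")
      case True
      then show ?thesis using kK nc f(1) pr by (auto simp: non_crossing_def K_def)
    next
      case False
      then show ?thesis using ij prd kK by (auto simp: is_diagonal_def crosses_def K_def)
    qed
    moreover have "i < k" "k < j" "p < r"
      using prd kK by (simp_all add: is_diagonal_def K_def)
    moreover have "k < p \<and> p < j \<and> j < r \<or> p < k \<and> k < r \<and> r < j"
      using f(2) pr by (auto simp: crosses_def)
    ultimately have "p = i" "k < r" "r < j"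
      unfolding crosses_def prod.case by linarith+
    then have "r \<in> K" using f(1) pr kK by (auto simp: K_def)
    then show False using kmax \<open>k < r\<close> by fastforce
  qed
  then show ?thesis using kK by (auto simp: K_def)
qed

lemma orientation_side: "orientation n g \<Longrightarrow> i < n \<Longrightarrow> g i (nxt n i)"
  unfolding orientation_def by blast

lemma orientation_antisym: "orientation n g \<Longrightarrow> i < n \<Longrightarrow> j < n \<Longrightarrow> g i j \<Longrightarrow> \<not> g j i"
  unfolding orientation_def by blast

lemma orientation_acyclic:
  "orientation n g \<Longrightarrow> i < n \<Longrightarrow> j < n \<Longrightarrow> k < n \<Longrightarrow> g i j \<Longrightarrow> g j k \<Longrightarrow> g k i \<Longrightarrow> \<not> between i j k"
  unfolding orientation_def by blast

lemma orientation_apex: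
  "orientation n g \<Longrightarrow> i < n \<Longrightarrow> j < n \<Longrightarrow> i \<noteq> j \<Longrightarrow> j \<noteq> nxt n i \<Longrightarrow> \<not> g j i \<Longrightarrow>
    \<exists>k<n. between i k j \<and> g i k \<and> g k j"
  unfolding orientation_def by blast

section \<open>From an orientation to a saturated blocker\<close>

context
  fixes n :: nat and g :: "nat \<Rightarrow> nat \<Rightarrow> bool"
  assumes orientation_g: "orientation n g" and n3: "3 \<le> n"
begin

lemmas side = orientation_side[OF orientation_g]
lemmas antisym = orientation_antisym[OF orientation_g]
lemmas acyclic = orientation_acyclic[OF orientation_g]
lemmas apex = orientation_apex[OF orientation_g]

lemma unoriented_diagonal: "unoriented n g \<subseteq> diagonals n"
proof
  fix e assume "e \<in> unoriented n g"
  then obtain i j where e: "e = (i, j)" and ij: "i < j" "j < n" "\<not> g i j" "\<not> g j i"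
    by (auto simp: unoriented_def)
  have "j \<noteq> Suc i" using side[of i] ij by (auto simp: nxt_def)
  moreover have "\<not> (i = 0 \<and> j = n - 1)" using side[of j] ij by (auto simp: nxt_def)
  ultimately show "e \<in> diagonals n" using e ij by (auto simp: diagonals_def is_diagonal_def)
qed

text \<open>In a triangulation avoiding the unoriented chords, every edge and side would be directed
  from its smaller to its larger end: an apex gives a path of two arcs, and acyclicity forbids a
  third arc closing it. But the side between \<open>0\<close> and \<open>n - 1\<close> points the
  other way.\<close>

lemma blocker_unoriented: "blocker n (unoriented n g)"
  unfolding blocker_def
proof (intro conjI allI impI notI unoriented_diagonal)
  fix T assume T: "triangulation n T" and disj: "unoriented n g \<inter> T = {}"
  have "g i j" if "i < j" "j < n" "is_diagonal n (i, j) \<longrightarrow> (i, j) \<in> T" for i j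
    using that
  proof (induction "j - i" arbitrary: i j rule: less_induct)
    case less
    show ?case
    proof (cases "j = Suc i")
      case True
      then show ?thesis using side[of i] less.prems by (auto simp: nxt_def)
    next
      case False
      obtain k where k: "i < k" "k < j" "is_diagonal n (i, k) \<longrightarrow> (i, k) \<in> T"
          "is_diagonal n (k, j) \<longrightarrow> (k, j) \<in> T"
        using triangulation_apex[OF T less.prems(1,2) False less.prems(3)] by blast
      have ik: "g i k" and kj: "g k j"
        using less.hyps[of k i] less.hyps[of j k] k less.prems by auto
      have "\<not> g j i"
        using acyclic[OF _ _ _ ik kj] k less.prems by (auto simp: between_def)
      moreover have "g i j \<or> g j i"
      proof (cases "is_diagonal n (i, j)")
        case True
        then have "(i, j) \<notin> unoriented n g" using less.prems disj by blast
        then show ?thesis using less.prems by (auto simp: unoriented_def)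
      next
        case nd: False
        then have "i = 0 \<and> j = n - 1" using less.prems False by (auto simp: is_diagonal_def)
        then show ?thesis using side[of j] less.prems by (auto simp: nxt_def)
      qed
      ultimately show ?thesis by blast
    qed
  qed
  then have "g 0 (n - 1)" using n3 by (auto simp: is_diagonal_def)
  moreover have "g (n - 1) 0" using side[of "n - 1"] n3 by (auto simp: nxt_def)
  ultimately show False using antisym[of 0 "n - 1"] n3 by auto
qed

text \<open>An arc that is not a side has an apex joined to it by two shorter arcs, so the
  triangulation is built recursively down to sides.\<close>

lemma forward_triangulates:
  "i < j \<Longrightarrow> j < n \<Longrightarrow> g i j \<Longrightarrow> \<exists>S. triangulates i j S \<and> S \<inter> unoriented n g = {}"
proof (induction "j - i" arbitrary: i j rule: less_induct)
  case less
  have nu: "(i, j) \<notin> unoriented n g" using less.prems by (auto simp: unoriented_def)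
  show ?case
  proof (cases "j = Suc i")
    case True
    then show ?thesis using triangulates.side nu by blast
  next
    case False
    then have "j \<noteq> nxt n i" using less.prems by (auto simp: nxt_def)
    then obtain k where k: "between i k j" "g i k" "g k j"
      using apex[of i j] antisym[of i j] less.prems by auto
    then have "i < k" "k < j" using less.prems by (auto simp: between_def)
    then obtain S S' where "triangulates i k S" "S \<inter> unoriented n g = {}"
      "triangulates k j S'" "S' \<inter> unoriented n g = {}"
      using less.hyps[of k i] less.hyps[of j k] k less.prems by fastforce
    then show ?thesis using nu triangulates.glue[of i k S j S'] by blast
  qed
qed

text \<open>The triangulated polygon grows outwards. Without an arc from \<open>i\<close> to
  \<open>j\<close> the far side has an apex \<open>k\<close>, and the enlarged polygon has root
  \<open>(k, j)\<close> or \<open>(i, k)\<close>, again not directed forward. This repeats until the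
  root is \<open>(0, n - 1)\<close>.\<close>

lemma backward_triangulates:
  "i < j \<Longrightarrow> j < n \<Longrightarrow> \<not> g i j \<Longrightarrow> triangulates i j S \<Longrightarrow>
   \<exists>S'. triangulates 0 (n - 1) S' \<and> S' \<inter> unoriented n g \<subseteq> S"
proof (induction "n - (j - i)" arbitrary: i j S rule: less_induct)
  case less
  show ?case
  proof (cases "i = 0 \<and> j = n - 1")
    case True
    then show ?thesis using less.prems by blast
  next
    case False
    then have "i \<noteq> nxt n j" using less.prems by (auto simp: nxt_def)
    then obtain k where k: "k < n" "between j k i" "g j k" "g k i"
      using apex[of j i] less.prems by auto
    show ?thesis
    proof (cases "k < i")
      case True
      obtain S2 where S2: "triangulates k i S2" "S2 \<inter> unoriented n g = {}"
        using forward_triangulates[of k i] True k less.prems by auto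
      have "triangulates k j (insert (k, j) (S2 \<union> S))"
        using triangulates.glue[OF S2(1) less.prems(4)] .
      moreover have "\<not> g k j" using antisym[of j k] k less.prems by auto
      ultimately obtain S' where "triangulates 0 (n - 1) S'"
          "S' \<inter> unoriented n g \<subseteq> insert (k, j) (S2 \<union> S)"
        using less.hyps[of j k] True less.prems by fastforce
      moreover have "(k, j) \<notin> unoriented n g" using k by (auto simp: unoriented_def)
      ultimately show ?thesis using S2(2) by blast
    next
      case False
      then have jk: "j < k" using k less.prems by (auto simp: between_def)
      obtain S2 where S2: "triangulates j k S2" "S2 \<inter> unoriented n g = {}"
        using forward_triangulates[of j k] jk k less.prems by auto
      have "triangulates i k (insert (i, k) (S \<union> S2))"
        using triangulates.glue[OF less.prems(4) S2(1)] .
      moreover have "\<not> g i k" using antisym[of k i] k less.prems by auto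
      ultimately obtain S' where "triangulates 0 (n - 1) S'"
          "S' \<inter> unoriented n g \<subseteq> insert (i, k) (S \<union> S2)"
        using less.hyps[of k i] jk k less.prems by fastforce
      moreover have "(i, k) \<notin> unoriented n g" using k by (auto simp: unoriented_def)
      ultimately show ?thesis using S2(2) by blast
    qed
  qed
qed

text \<open>The two arcs at an apex triangulate one side of an unoriented chord, and
  \<open>backward_triangulates\<close> fills the other. The result contains no further unoriented
  chord.\<close>

lemma saturated_unoriented: "saturated_blocker n (unoriented n g)"
  unfolding saturated_blocker_def
proof (intro conjI ballI blocker_unoriented)
  fix e assume eX: "e \<in> unoriented n g"
  then obtain i j where e: "e = (i, j)" and ij: "i < j" "j < n" "\<not> g i j" "\<not> g j i"
    by (auto simp: unoriented_def)
  have "j \<noteq> nxt n i" using side[of i] ij by auto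
  then obtain k where k: "between i k j" "g i k" "g k j"
    using apex[of i j] ij by auto
  then have ikj: "i < k" "k < j" using ij by (auto simp: between_def)
  obtain S1 S2 where S: "triangulates i k S1" "S1 \<inter> unoriented n g = {}"
      "triangulates k j S2" "S2 \<inter> unoriented n g = {}"
    using forward_triangulates[of i k] forward_triangulates[of k j] k ikj ij by auto
  obtain S where tri: "triangulates 0 (n - 1) S" and sub: "S \<inter> unoriented n g \<subseteq> insert (i, j) (S1 \<union> S2)"
    using backward_triangulates[OF ij(1-3) triangulates.glue[OF S(1,3)]] by blast
  have "(unoriented n g - {e}) \<inter> (S \<inter> diagonals n) = {}" using sub S(2,4) e by blast
  then show "\<not> blocker n (unoriented n g - {e})"
    using triangulation_of_triangulates[OF tri] by (auto simp: blocker_def)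
qed

end

section \<open>Splitting a block\<close>

definition leaf :: "nat \<Rightarrow> (nat \<Rightarrow> nat \<Rightarrow> bool) \<Rightarrow> nat \<Rightarrow> nat \<Rightarrow> nat \<Rightarrow> bool" where
  "leaf n g x m k \<longleftrightarrow>
     1 \<le> x \<and> 1 \<le> m \<and> x + m < n \<and> k < n \<and> k \<notin> {x..<x+m} \<and>
     (\<forall>v<n. v \<notin> {x..<x+m} \<longrightarrow> (\<forall>u\<in>{x..<x+m}. g v u = g v x \<and> g u v = g x v)) \<and>
     (\<forall>u\<in>{x..<x+m}. \<forall>w\<in>{x..<x+m}. g u w \<longleftrightarrow> u < w) \<and>
     g (x - 1) x \<and> g x (x + m) \<and> g (x + m) k \<and> g k (x - 1) \<and> \<not> g k x \<and> \<not> g x k \<and>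
     (\<forall>w<n. w \<notin> {x..<x+m} \<and> w \<noteq> x + m \<and> g x w \<and> between x w k \<longrightarrow> \<not> g w k) \<and>
     (\<forall>v<n. v \<notin> {x..<x+m} \<and> \<not> g x v \<and> \<not> g v x \<and> v \<noteq> k \<longrightarrow>
        (\<exists>w<n. w \<notin> {x..<x+m} \<and> w \<noteq> x + m \<and> g x w \<and> g w v \<and> between x w v))"

text \<open>
In a leaf, the last condition but one keeps the new arcs from \<^term>\<open>k\<close> into a rewired block from
closing a directed triangle. The last one provides an exit other than \<^term>\<open>x + m\<close>, the
successor of the block, because part of the block loses its arc to the successor.
\<close>

lemma leaf_twins:
  assumes "leaf n g x m k"
  shows "v < n \<Longrightarrow> v \<notin> {x..<x+m} \<Longrightarrow> u \<in> {x..<x+m} \<Longrightarrow> g v u = g v x"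
    "v < n \<Longrightarrow> v \<notin> {x..<x+m} \<Longrightarrow> u \<in> {x..<x+m} \<Longrightarrow> g u v = g x v"
  using assms unfolding leaf_def by blast+

lemma leaf_clique:
  "leaf n g x m k \<Longrightarrow> u \<in> {x..<x+m} \<Longrightarrow> w \<in> {x..<x+m} \<Longrightarrow> g u w \<longleftrightarrow> u < w"
  unfolding leaf_def by blast

lemma leaf_special:
  assumes "leaf n g x m k"
  shows "g (x - 1) x" "g x (x + m)" "g (x + m) k" "g k (x - 1)" "\<not> g k x" "\<not> g x k"
  using assms unfolding leaf_def by blast+

lemma leaf_no_short_return:
  "leaf n g x m k \<Longrightarrow> w < n \<Longrightarrow> w \<notin> {x..<x+m} \<Longrightarrow> w \<noteq> x + m \<Longrightarrow> g x w \<Longrightarrow> between x w k \<Longrightarrow> \<not> g w k"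
  unfolding leaf_def by blast

lemma leaf_second_exit:
  "leaf n g x m k \<Longrightarrow> v < n \<Longrightarrow> v \<notin> {x..<x+m} \<Longrightarrow> \<not> g x v \<Longrightarrow> \<not> g v x \<Longrightarrow> v \<noteq> k \<Longrightarrow>
    \<exists>w<n. w \<notin> {x..<x+m} \<and> w \<noteq> x + m \<and> g x w \<and> g w v \<and> between x w v"
  unfolding leaf_def by blast

text \<open>
Roles 2 and 6 are the two new blocks, of sizes \<^term>\<open>m1\<close> and \<^term>\<open>m2\<close>; the other six roles are
single vertices.
\<close>

definition role :: "nat \<Rightarrow> nat \<Rightarrow> nat \<Rightarrow> nat \<Rightarrow> nat" where
  "role x m1 m2 i =
     (if i \<le> x then 0 else if i \<le> x + 1 then 1 else if i < x + 2 + m1 then 2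
      else if i \<le> x + 2 + m1 then 3 else if i \<le> x + 3 + m1 then 4 else if i \<le> x + 4 + m1 then 5
      else if i < x + 5 + m1 + m2 then 6 else 7)"

text \<open>The pattern is itself an orientation of the octagon whose vertices are the eight roles
  in cyclic order; its sides are the steps \<open>(t, t + 1)\<close> and \<open>(7, 0)\<close>. The
  pair of roles 2 and 6 is left unoriented, which puts all chords between the two new blocks into
  the blocker.\<close>

definition arcs :: "(nat \<times> nat) set" where
  "arcs = {(0,1),(1,2),(2,3),(2,5),(3,0),(3,4),(3,5),(4,0),(4,1),(4,5),(4,6),(5,0),(5,6),
           (6,0),(6,1),(6,7),(7,0),(7,1),(7,2),(7,3)}"

text \<open>Outside the block only the links to its successor \<open>q\<close> and to
  \<open>k\<close> are affected: roles 1 and 4 lose their arc to \<open>q\<close>, role 0 has it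
  reversed, and roles 0, 1, 4 receive new arcs from \<open>k\<close>.\<close>

definition refine :: "(nat \<Rightarrow> nat \<Rightarrow> bool) \<Rightarrow> nat \<Rightarrow> nat \<Rightarrow> nat \<Rightarrow> nat \<Rightarrow> nat \<Rightarrow> nat \<Rightarrow> bool" where
  "refine g x m1 m2 k i j =
     (let U = {x..<x+(m1+m2+6)}; q = x+(m1+m2+6); r = role x m1 m2 in
      if i \<in> U \<and> j \<in> U then (if r i = r j then i < j else (r i, r j) \<in> arcs)
      else if j \<in> U \<and> i = q then r j = 0
      else if i \<in> U \<and> j = q then r i \<in> {2,3,5,6,7}
      else if j \<in> U \<and> i = k then r j \<in> {0,1,4}
      else g i j)"

lemma less_8: "(t::nat) < 8 \<Longrightarrow> t = 0 \<or> t = 1 \<or> t = 2 \<or> t = 3 \<or> t = 4 \<or> t = 5 \<or> t = 6 \<or> t = 7"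
  by linarith

lemma all_less_8:
  "(\<forall>r<8. P r) \<longleftrightarrow> P (0::nat) \<and> P 1 \<and> P 2 \<and> P 3 \<and> P 4 \<and> P 5 \<and> P 6 \<and> P 7"
proof -
  have "r < 8 \<longleftrightarrow> r = 0 \<or> r = 1 \<or> r = 2 \<or> r = 3 \<or> r = 4 \<or> r = 5 \<or> r = 6 \<or> r = 7" for r :: nat
    by linarith
  then show ?thesis by metis
qed

lemma ex_less_8:
  "(\<exists>r<8. P r) \<longleftrightarrow> P (0::nat) \<or> P 1 \<or> P 2 \<or> P 3 \<or> P 4 \<or> P 5 \<or> P 6 \<or> P 7"
  using all_less_8[of "\<lambda>r. \<not> P r"] by blast

lemma arcs_antisym: "r < 8 \<Longrightarrow> s < 8 \<Longrightarrow> (r, s) \<in> arcs \<Longrightarrow> (s, r) \<notin> arcs"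
proof -
  have "\<forall>r<8. \<forall>s<8. (r, s) \<in> arcs \<longrightarrow> (s, r) \<notin> arcs"
    unfolding all_less_8 by (simp add: arcs_def)
  then show "r < 8 \<Longrightarrow> s < 8 \<Longrightarrow> (r, s) \<in> arcs \<Longrightarrow> (s, r) \<notin> arcs" by blast
qed

lemma arcs_increasing:
  assumes "(r, s) \<in> arcs" "r < s"
  shows "(r, s) \<in> {(0,1),(1,2),(2,3),(2,5),(3,4),(3,5),(4,5),(4,6),(5,6),(6,7)}"
  using assms unfolding arcs_def by (elim insertE emptyE) simp_all

lemma arcs_acyclic:
  assumes "r < s" "s < t" "(r, s) \<in> arcs" "(s, t) \<in> arcs"
  shows "(t, r) \<notin> arcs"
  using arcs_increasing[OF assms(3,1)] arcs_increasing[OF assms(4,2)]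
  by (elim insertE emptyE) (simp_all add: arcs_def)

lemma arcs_forward:
  assumes "r < s" "s < 8" "(s, r) \<notin> arcs" "s \<noteq> Suc r"
  shows "\<exists>t<8. r < t \<and> t < s \<and> (r, t) \<in> arcs \<and> (t, s) \<in> arcs"
proof -
  have "\<forall>r<8. \<forall>s<8. r < s \<and> (s, r) \<notin> arcs \<and> s \<noteq> Suc r \<longrightarrow>
     (\<exists>t<8. r < t \<and> t < s \<and> (r, t) \<in> arcs \<and> (t, s) \<in> arcs)"
    unfolding all_less_8 ex_less_8 by (simp add: arcs_def)
  then show ?thesis using assms by simp
qed

text \<open>The excluded pair is the side from role 7 to role 0 of the octagon. In the full polygon
  the vertex \<open>q\<close> lies between these two roles and serves as apex.\<close>

lemma arcs_backward:
  assumes "s < r" "r < 8" "(s, r) \<notin> arcs" "\<not> (r = 7 \<and> s = 0)"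
  shows "\<exists>t<8. (t < s \<or> r < t) \<and> (r, t) \<in> arcs \<and> (t, s) \<in> arcs"
proof -
  have "\<forall>r<8. \<forall>s<8. s < r \<and> (s, r) \<notin> arcs \<and> \<not> (r = 7 \<and> s = 0) \<longrightarrow>
     (\<exists>t<8. (t < s \<or> r < t) \<and> (r, t) \<in> arcs \<and> (t, s) \<in> arcs)"
    unfolding all_less_8 ex_less_8 by (simp add: arcs_def)
  then show ?thesis using assms by simp
qed

lemma between_shift:
  "u \<in> {x..<x+m} \<Longrightarrow> u' \<in> {x..<x+m} \<Longrightarrow> v \<notin> {x..<x+m} \<Longrightarrow> w \<notin> {x..<x+m} \<Longrightarrow> between u v w \<longleftrightarrow> between u' v w"
  unfolding between_def atLeastLessThan_iff by linarith

lemma between_rotate: "between i j k \<longleftrightarrow> between j k i"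
  by (auto simp: between_def)

section \<open>The rewired relation is an orientation\<close>

locale refinement =
  fixes n :: nat and g :: "nat \<Rightarrow> nat \<Rightarrow> bool" and x m1 m2 k :: nat
  assumes orientation_g: "orientation n g" and leaf_g: "leaf n g x (m1 + m2 + 6) k"
    and m1: "1 \<le> m1" and m2: "1 \<le> m2"
begin

abbreviation "m \<equiv> m1 + m2 + 6"
abbreviation "q \<equiv> x + m"
abbreviation "U \<equiv> {x..<q}"
abbreviation "r \<equiv> role x m1 m2"
abbreviation "h \<equiv> refine g x m1 m2 k"

lemmas side = orientation_side[OF orientation_g]
lemmas antisym = orientation_antisym[OF orientation_g]
lemmas acyclic = orientation_acyclic[OF orientation_g]
lemmas apex = orientation_apex[OF orientation_g]
lemmas twins = leaf_twins[OF leaf_g]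
lemmas special = leaf_special[OF leaf_g]
lemmas no_short_return = leaf_no_short_return[OF leaf_g]
lemmas second_exit = leaf_second_exit[OF leaf_g]

lemma bounds: "1 \<le> x" "q < n" "k < n" "k \<notin> U"
  using leaf_g unfolding leaf_def by auto

lemma U_less: "u \<in> U \<Longrightarrow> u < n"
  using bounds by auto

lemma x_in_U: "x \<in> U" by simp

lemma k_neq: "k \<noteq> q" "k \<noteq> x - 1"
  using special antisym[of k k] bounds by auto

lemma not_g_q: "\<not> g q x"
  using antisym[of x q] special bounds by auto

lemma h_outside: "i \<notin> U \<Longrightarrow> j \<notin> U \<Longrightarrow> h i j = g i j"
  by (auto simp: refine_def Let_def)

lemma h_inside: "i \<in> U \<Longrightarrow> j \<in> U \<Longrightarrow> h i j = (if r i = r j then i < j else (r i, r j) \<in> arcs)"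
  by (auto simp: refine_def Let_def)

lemma h_into: "i < n \<Longrightarrow> i \<notin> U \<Longrightarrow> j \<in> U \<Longrightarrow>
    h i j = (if i = q then r j = 0 else if i = k then r j \<in> {0,1,4} else g i x)"
  using twins[of i j] by (auto simp: refine_def Let_def)

lemma h_out: "j < n \<Longrightarrow> j \<notin> U \<Longrightarrow> i \<in> U \<Longrightarrow>
    h i j = (if j = q then r i \<in> {2,3,5,6,7} else g x j)"
  using twins[of j i] by (auto simp: refine_def Let_def)

text \<open>Before the split neither \<open>q\<close> nor \<open>k\<close> had an arc into the
  block, so the two exceptional rules can only add such arcs.\<close>

lemma h_into_I: "i < n \<Longrightarrow> i \<notin> U \<Longrightarrow> j \<in> U \<Longrightarrow> g i x \<Longrightarrow> h i j"
  using h_into[of i j] not_g_q special by auto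

lemma role_less: "r i < 8"
  by (auto simp: role_def)

lemma role_mono: "i \<le> j \<Longrightarrow> r i \<le> r j"
  unfolding role_def by simp

lemma role_rep: "t < 8 \<Longrightarrow> \<exists>i\<in>U. r i = t"
proof -
  have "\<forall>t<8. \<exists>i\<in>U. r i = t"
    unfolding all_less_8
  proof (intro conjI)
    show "\<exists>i\<in>U. r i = 0" by (rule bexI[of _ x]) (auto simp: role_def)
    show "\<exists>i\<in>U. r i = 1" by (rule bexI[of _ "x+1"]) (auto simp: role_def)
    show "\<exists>i\<in>U. r i = 2" using m1 by (intro bexI[of _ "x+2"]) (auto simp: role_def)
    show "\<exists>i\<in>U. r i = 3" by (rule bexI[of _ "x+2+m1"]) (auto simp: role_def)
    show "\<exists>i\<in>U. r i = 4" by (rule bexI[of _ "x+3+m1"]) (auto simp: role_def)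
    show "\<exists>i\<in>U. r i = 5" by (rule bexI[of _ "x+4+m1"]) (auto simp: role_def)
    show "\<exists>i\<in>U. r i = 6" using m2 by (intro bexI[of _ "x+5+m1"]) (auto simp: role_def)
    show "\<exists>i\<in>U. r i = 7" by (rule bexI[of _ "x+5+m1+m2"]) (auto simp: role_def)
  qed
  then show "t < 8 \<Longrightarrow> \<exists>i\<in>U. r i = t" by blast
qed

lemma role_Suc: "r i = r (Suc i) \<or> r (Suc i) = Suc (r i)"
  using m1 m2 by (auto simp: role_def)

lemma arcs_Suc: "t < 7 \<Longrightarrow> (t, Suc t) \<in> arcs"
proof -
  assume "t < 7"
  then have "t = 0 \<or> t = 1 \<or> t = 2 \<or> t = 3 \<or> t = 4 \<or> t = 5 \<or> t = 6" by linarith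
  then show ?thesis by (auto simp: arcs_def)
qed

lemma h_Suc: "i \<in> U \<Longrightarrow> Suc i \<in> U \<Longrightarrow> h i (Suc i)"
  using h_inside[of i "Suc i"] role_Suc[of i] arcs_Suc[of "r i"] role_less[of "Suc i"] by auto

lemma role_first: "r x = 0" and role_last: "r (q - 1) = 7"
  using m1 m2 by (auto simp: role_def)

lemma h_side: "i < n \<Longrightarrow> h i (nxt n i)"
proof -
  assume i: "i < n"
  have nx: "nxt n i = (if i = n - 1 then 0 else Suc i)" using i by (auto simp: nxt_def)
  have "Suc i \<in> U" if "i \<in> U" "i \<noteq> q - 1" using that by auto
  moreover have "nxt n i \<notin> U" if "i \<notin> U" "i \<noteq> x - 1" 
    by (cases "Suc i = n") (use that bounds in \<open>auto simp: nxt_def\<close>)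
  ultimately consider "i \<in> U" "Suc i \<in> U" | "i = q - 1" | "i = x - 1" | "i \<notin> U" "nxt n i \<notin> U"
    by blast
  then show ?thesis
  proof cases
    case 1
    then have "nxt n i = Suc i" using bounds by (auto simp: nxt_def)
    then show ?thesis using h_Suc 1 by simp
  next
    case 2
    then have "nxt n i = q" using bounds by (auto simp: nxt_def)
    then show ?thesis using h_out[of q i] 2 role_last bounds by auto
  next
    case 3
    then have "nxt n i = x" using bounds by (auto simp: nxt_def)
    then show ?thesis using h_into_I[of i x] special 3 bounds by auto
  next
    case 4
    then show ?thesis using h_outside side i by simp
  qed
qed

lemma h_antisym: "i < n \<Longrightarrow> j < n \<Longrightarrow> h i j \<Longrightarrow> \<not> h j i"
proof -
  assume ij: "i < n" "j < n" "h i j"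
  consider "i \<in> U" "j \<in> U" | "i \<in> U" "j \<notin> U" | "i \<notin> U" "j \<in> U" | "i \<notin> U" "j \<notin> U" by blast
  then show ?thesis
  proof cases
    case 1
    then show ?thesis using ij(3) h_inside[of i j] h_inside[of j i] arcs_antisym[OF role_less role_less, of i j]
      by (auto split: if_splits)
  next
    case 2
    have "\<not> (g j x \<and> g x j)" using antisym[of x j] ij bounds by auto
    then show ?thesis using ij h_out[of j i] h_into[of j i] 2 special by (auto split: if_splits)
  next
    case 3
    have "\<not> (g i x \<and> g x i)" using antisym[of x i] ij bounds by auto
    then show ?thesis using ij h_out[of i j] h_into[of i j] 3 special by (auto split: if_splits)
  next
    case 4
    then show ?thesis using ij antisym h_outside by auto
  qed
qed


text \<open>If the closing arc is old, the triangle already existed in \<open>g\<close> at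
  \<open>x\<close>. A new arc from \<open>q\<close> closes no clockwise triangle, because no outside
  vertex lies between the block and \<open>q\<close>. A new arc from \<open>k\<close> ends in role
  0, 1 or 4, which has no arc to \<open>q\<close>; \<open>leaf_no_short_return\<close> excludes the
  other middle vertices.\<close>

lemma h_acyclic_outside:
  assumes "i \<in> U" "j < n" "j \<notin> U" "l < n" "l \<notin> U" "h i j" "h j l" "h l i"
  shows "\<not> between i j l"
proof
  assume b: "between i j l"
  then have bx: "between x j l" using between_shift[of i x m x j l] assms by auto
  have gjl: "g j l" using assms h_outside by auto
  have gxj: "g x j" using assms h_out[of j i] special by (auto split: if_splits)
  show False
  proof (cases "g l x")
    case True
    then show False using acyclic[of x j l] gxj gjl bx assms bounds by auto
  next
    case False
    then have "l = q \<and> r i = 0 \<or> l = k \<and> r i \<in> {0,1,4}"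
      using assms h_into[of l i] by (auto split: if_splits)
    then show False
    proof
      assume "l = q \<and> r i = 0"
      then show False using bx assms(3) by (auto simp: between_def)
    next
      assume *: "l = k \<and> r i \<in> {0,1,4}"
      then have "j \<noteq> q" using assms(6) h_out[of j i] assms by auto
      then show False using no_short_return[of j] * assms gxj gjl bx by auto
    qed
  qed
qed

text \<open>An outside vertex with arcs both from and to the block can only be \<open>q\<close>. Its
  arcs into the block end in role 0, which has no arc to a role pointing to
  \<open>q\<close>.\<close>

lemma h_acyclic_mixed:
  assumes "i \<in> U" "j \<in> U" "l < n" "l \<notin> U" "h i j" "h j l"
  shows "\<not> h l i"
proof
  assume li: "h l i"
  have xl: "g x l" using assms h_out[of l j] special by (auto split: if_splits)
  have "\<not> g l x" using xl antisym[of x l] assms bounds by auto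
  then have "l = q \<and> r i = 0 \<or> l = k"
    using assms li h_into[of l i] by (auto split: if_splits)
  moreover have "l \<noteq> k" using xl special by auto
  ultimately have "l = q" "r i = 0" by auto
  then have "r j \<in> {2,3,5,6,7}" using assms h_out[of l j] bounds by auto
  then have "(0, r j) \<in> arcs" using assms(1,2,5) h_inside[of i j] \<open>r i = 0\<close> by (auto split: if_splits)
  then show False using \<open>r j \<in> {2,3,5,6,7}\<close> by (auto simp: arcs_def)
qed

lemma h_acyclic_inside:
  assumes "i \<in> U" "j \<in> U" "l \<in> U" "h i j" "h j l" "i < j" "j < l"
  shows "\<not> h l i"
proof (cases "r i = r j \<or> r j = r l")
  case False
  then have "r i < r j" "r j < r l" using role_mono[of i j] role_mono[of j l] assms by auto
  then show ?thesis using arcs_acyclic[of "r i" "r j" "r l"] assms h_inside by auto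
next
  case True
  then show ?thesis
    using assms h_inside[of i j] h_inside[of j l] h_inside[of l i] arcs_antisym[OF role_less role_less]
    by (auto split: if_splits)
qed

lemma h_acyclic:
  assumes "i < n" "j < n" "l < n" "h i j" "h j l" "h l i"
  shows "\<not> between i j l"
proof
  assume b: "between i j l"
  have b': "between j l i" "between l i j" using b between_rotate by blast+
  consider "i \<in> U" "j \<in> U" "l \<in> U" | "i \<notin> U" "j \<notin> U" "l \<notin> U"
    | "i \<in> U" "j \<in> U" "l \<notin> U" | "j \<in> U" "l \<in> U" "i \<notin> U" | "l \<in> U" "i \<in> U" "j \<notin> U"
    | "i \<in> U" "j \<notin> U" "l \<notin> U" | "j \<in> U" "l \<notin> U" "i \<notin> U" | "l \<in> U" "i \<notin> U" "j \<notin> U"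
    by blast
  then show False
  proof cases
    case 1
    then show False
      using b assms h_acyclic_inside[of i j l] h_acyclic_inside[of j l i] h_acyclic_inside[of l i j]
      unfolding between_def by blast
  next
    case 2
    then show False using acyclic[of i j l] b assms h_outside by auto
  next
    case 3
    then show False using h_acyclic_mixed[of i j l] assms by blast
  next
    case 4
    then show False using h_acyclic_mixed[of j l i] assms by blast
  next
    case 5
    then show False using h_acyclic_mixed[of l i j] assms by blast
  next
    case 6
    then show False using h_acyclic_outside[of i j l] assms b by blast
  next
    case 7
    then show False using h_acyclic_outside[of j l i] assms b' by blast
  next
    case 8
    then show False using h_acyclic_outside[of l i j] assms b' by blast
  qed
qed

lemma h_apex_outside:
  assumes "i < n" "j < n" "i \<noteq> j" "j \<noteq> nxt n i" "\<not> h j i" "i \<notin> U" "j \<notin> U"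
  shows "\<exists>l<n. between i l j \<and> h i l \<and> h l j"
proof -
  obtain l where l: "l < n" "between i l j" "g i l" "g l j"
    using apex[of i j] assms h_outside by auto
  show ?thesis
  proof (cases "l \<in> U")
    case False
    then show ?thesis using l assms h_outside by blast
  next
    case True
    \<comment> \<open>Role 2 keeps every arc that the old block had to or from the outside, so it
      can replace any apex inside the block.\<close>
    obtain u where u: "u \<in> U" "r u = 2" using role_rep[of 2] by auto
    have "g i x" "g x j" using twins[of i l] twins[of j l] l True assms by auto
    then have "h i u" "h u j"
      using h_into_I[of i u] h_out[of j u] u assms by auto
    moreover have "between i u j"
      using between_shift[of l x m u j i] between_rotate[of l j i] between_rotate[of u j i]
        between_rotate[of i l j] between_rotate[of i u j] l u True assms by simp
    ultimately show ?thesis using u U_less by blast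
  qed
qed

text \<open>Seen from outside, the vertices strictly before \<open>x\<close> avoid the block, so an
  apex towards \<open>x\<close> is not affected by the rewiring.\<close>

lemma pred_apex:
  assumes "i < n" "i \<notin> U" "i \<noteq> x - 1" "\<not> g x i"
  shows "\<exists>l<n. l \<notin> U \<and> between i l x \<and> g i l \<and> g l x"
proof -
  have "x \<noteq> nxt n i" "i \<noteq> x" using assms bounds by (auto simp: nxt_def split: if_splits)
  then obtain l where l: "l < n" "between i l x" "g i l" "g l x"
    using apex[of i x] assms bounds by auto
  moreover have "l \<notin> U" using l(2) assms(2) by (auto simp: between_def)
  ultimately show ?thesis by blast
qed

lemma h_apex_into:
  assumes "i < n" "j < n" "j \<noteq> nxt n i" "\<not> h j i" "i \<notin> U" "j \<in> U"
  shows "\<exists>l<n. between i l j \<and> h i l \<and> h l j"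
proof -
  have shift: "between i l j" if "between i l x" "l \<notin> U" for l
    using that between_shift[of x x m j i l] between_rotate[of x i l] between_rotate[of j i l] assms by simp
  consider "i = q" | "i \<noteq> q" "g x i" | "i = k" | "g i x" | "\<not> g x i" "\<not> g i x" "i \<noteq> k" by blast
  then show ?thesis
  proof cases
    case 1
    then have "r j \<notin> {2,3,5,6,7}" using assms h_out[of i j] by auto
    then consider "r j \<in> {0,4}" | "r j = 1" using role_less[of j] by force
    then show ?thesis
    proof cases
      case 1
      have "h q k" using h_outside[of q k] special bounds by auto
      moreover have "h k j" using h_into[of k j] k_neq 1 bounds assms by auto
      moreover have "between q k j" using bounds k_neq assms by (auto simp: between_def)
      ultimately show ?thesis using bounds \<open>i = q\<close> by blast
    next
      case r1: 2
      have "h q x" using h_into[of q x] role_first bounds by auto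
      moreover have "h x j" using h_inside[of x j] r1 role_first assms by (auto simp: arcs_def)
      moreover have "between q x j"
      proof -
        have "j \<noteq> x" using r1 role_first by auto
        then show ?thesis using assms by (auto simp: between_def)
      qed
      ultimately show ?thesis using U_less[OF x_in_U] \<open>i = q\<close> by blast
    qed
  next
    case 2
    then show ?thesis using assms h_out[of i j] by auto
  next
    case 3
    have "h k (x - 1)" using h_outside[of k "x - 1"] special bounds by auto
    moreover have "h (x - 1) j" using h_into_I[of "x - 1" j] special bounds assms by auto
    moreover have "between k (x - 1) j"
      using bounds k_neq assms by (auto simp: between_def)
    ultimately show ?thesis using bounds 3 by (intro exI[of _ "x - 1"]) auto
  next
    case 4
    show ?thesis
    proof (cases "j = x")
      case True
      have "\<not> g x i" using 4 antisym[of x i] assms bounds by auto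
      moreover have "i \<noteq> x - 1" using assms(3) True bounds by (auto simp: nxt_def)
      ultimately obtain l where l: "l < n" "l \<notin> U" "between i l x" "g i l" "g l x"
        using pred_apex[of i] assms by blast
      then show ?thesis using h_outside[of i l] h_into_I[of l j] shift assms by blast
    next
      case False
      then have jm: "j - 1 \<in> U" "Suc (j - 1) = j" using assms(6) by auto
      have "between i (j - 1) j" using jm assms by (auto simp: between_def)
      moreover have "h i (j - 1)" using h_into_I[of i "j - 1"] jm 4 assms by blast
      moreover have "h (j - 1) j" using h_Suc[of "j - 1"] jm assms by simp
      ultimately show ?thesis using U_less[OF jm(1)] by blast
    qed
  next
    case 5
    then have "i \<noteq> x - 1" using special by auto
    then obtain l where l: "l < n" "l \<notin> U" "between i l x" "g i l" "g l x"
      using pred_apex[of i] 5 assms by blast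
    then show ?thesis using h_outside[of i l] h_into_I[of l j] shift assms by blast
  qed
qed

lemma h_apex_out:
  assumes "i < n" "j < n" "j \<noteq> nxt n i" "\<not> h j i" "i \<in> U" "j \<notin> U"
  shows "\<exists>l<n. between i l j \<and> h i l \<and> h l j"
proof -
  have shift: "between i l j" if "between u l j" "u \<in> U" "l \<notin> U" for l u
    using that between_shift[of u x m i l j] assms by simp
  consider "g j x" | "j = k" | "j = q" | "g x j" "j \<noteq> q" | "\<not> g x j" "\<not> g j x" "j \<noteq> k"
    by blast
  then show ?thesis
  proof cases
    case 1
    then show ?thesis using h_into_I[of j i] assms by blast
  next
    case 2
    then have "r i \<notin> {0,1,4}" using assms h_into[of j i] k_neq by auto
    then have "r i \<in> {2,3,5,6,7}" using role_less[of i] by force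
    then have "h i q" using h_out[of q i] bounds assms by auto
    moreover have "h q k" using h_outside[of q k] special bounds by auto
    moreover have "between i q k" using bounds k_neq assms by (auto simp: between_def)
    ultimately show ?thesis using bounds 2 by blast
  next
    case 3
    then have "r i \<noteq> 0" using assms h_into[of j i] by auto
    have "i \<noteq> q - 1" using assms(3) 3 bounds by (auto simp: nxt_def)
    then have "Suc i \<in> U" using assms(5) by auto
    \<comment> \<open>The successor of role 3 has role 4, which lost its arc to \<open>q\<close>, so
      role 5 serves as apex. In the other cases the next vertex still has an arc to
      \<open>q\<close>, because roles 1 and 4 are single vertices.\<close>
    show ?thesis
    proof (cases "r i = 3")
      case True
      obtain u where u: "u \<in> U" "r u = 5" using role_rep[of 5] by auto
      have "i < u" using role_mono[of u i] u True by (cases "i < u") auto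
      then have "between i u q" using u by (auto simp: between_def)
      moreover have "h i u" using h_inside[of i u] u True assms by (auto simp: arcs_def)
      moreover have "h u q" using h_out[of q u] u bounds by auto
      ultimately show ?thesis using U_less[OF u(1)] 3 by blast
    next
      case False
      have "r i \<in> {1,2,4,5,6,7}" using False \<open>r i \<noteq> 0\<close> role_less[of i] by force
      then have "r (Suc i) \<in> {2,3,5,6,7} \<or> r i = 1 \<and> r (Suc i) = 1 \<or> r i = 4 \<and> r (Suc i) = 4"
        using role_Suc[of i] role_less[of "Suc i"] by force
      moreover have "\<not> (r i = 1 \<and> r (Suc i) = 1)" "\<not> (r i = 4 \<and> r (Suc i) = 4)"
        using m1 m2 by (auto simp: role_def split: if_splits)
      ultimately have "h (Suc i) q" using h_out[of q "Suc i"] bounds \<open>Suc i \<in> U\<close> by auto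
      moreover have "h i (Suc i)" using h_Suc assms \<open>Suc i \<in> U\<close> by blast
      moreover have "between i (Suc i) q" using \<open>Suc i \<in> U\<close> by (auto simp: between_def)
      ultimately show ?thesis using U_less[OF \<open>Suc i \<in> U\<close>] 3 by blast
    qed
  next
    case 4
    \<comment> \<open>The next vertex of the block has the same arc to \<open>j\<close>. For the
      last vertex of the block, the apex given by \<open>g\<close> lies outside the block.\<close>
    show ?thesis
    proof (cases "i = q - 1")
      case True
      have "\<not> g j i" using antisym[of x j] 4 twins[of j i] assms bounds by auto
      then obtain l where l: "l < n" "between i l j" "g i l" "g l j"
        using apex[of i j] assms by auto
      have lU: "l \<notin> U" using l(2) True assms(6) by (auto simp: between_def)
      have "g x l" using l lU twins[of l i] assms by auto
      then have "h i l" using h_out[of l i] l lU True role_last assms by auto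
      then show ?thesis using l lU h_outside[of l j] assms by blast
    next
      case False
      then have S: "Suc i \<in> U" using assms(5) by auto
      have "between i (Suc i) j" using S assms by (auto simp: between_def)
      moreover have "h (Suc i) j" using h_out[of j "Suc i"] S 4 assms by auto
      moreover have "h i (Suc i)" using h_Suc assms S by blast
      ultimately show ?thesis using U_less[OF S] by blast
    qed
  next
    case 5
    then obtain w where w: "w < n" "w \<notin> U" "w \<noteq> q" "g x w" "g w j" "between x w j"
      using second_exit[of j] assms by blast
    then have "h i w" using h_out[of w i] assms by auto
    then show ?thesis using w shift[OF w(6) x_in_U w(2)] h_outside[of w j] assms by auto
  qed
qed

text \<open>The octagon pattern supplies the role of the apex, and \<open>role_mono\<close> turns
  the order of roles into the order of vertices. Going forward between equal or consecutive roles,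
  the apex is the next vertex.\<close>

lemma h_apex_inside:
  assumes "i \<noteq> j" "j \<noteq> Suc i" "\<not> h j i" "i \<in> U" "j \<in> U"
  shows "\<exists>l<n. between i l j \<and> h i l \<and> h l j"
proof (cases "i < j")
  case True
  then have S: "Suc i \<in> U" "Suc i < j" using assms by auto
  have le: "r i \<le> r (Suc i)" "r (Suc i) \<le> r j" using role_mono S by auto
  show ?thesis
  proof (cases "r j \<le> Suc (r i)")
    case near: True
    have "h (Suc i) j"
    proof (cases "r (Suc i) = r j")
      case True
      then show ?thesis using h_inside[of "Suc i" j] S assms by auto
    next
      case False
      then have "r j = Suc (r (Suc i))" using near le by auto
      then show ?thesis
        using h_inside[of "Suc i" j] S assms arcs_Suc[of "r (Suc i)"] role_less[of j] by auto
    qed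
    moreover have "h i (Suc i)" using h_Suc assms S by blast
    moreover have "between i (Suc i) j" using S by (auto simp: between_def)
    ultimately show ?thesis using U_less[OF S(1)] by blast
  next
    case False
    then have "(r j, r i) \<notin> arcs" using h_inside[of j i] assms by (auto split: if_splits)
    then obtain t where t: "t < 8" "r i < t" "t < r j" "(r i, t) \<in> arcs" "(t, r j) \<in> arcs"
      using arcs_forward[of "r i" "r j"] False role_less[of j] by auto
    obtain u where u: "u \<in> U" "r u = t" using role_rep t by blast
    have "i < u" "u < j" using role_mono[of u i] role_mono[of j u] u t by (meson leD leI)+
    then have "between i u j" by (auto simp: between_def)
    then show ?thesis using u t h_inside[of i u] h_inside[of u j] assms U_less[OF u(1)] by auto
  qed
next
  case False
  then have ji: "j < i" using assms by auto
  then have "r j \<noteq> r i" using assms h_inside[of j i] by auto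
  then have rji: "r j < r i" using role_mono[of j i] ji by auto
  have na: "(r j, r i) \<notin> arcs" using h_inside[of j i] assms rji by auto
  show ?thesis
  proof (cases "r i = 7 \<and> r j = 0")
    case True
    then have "h i q" "h q j" using h_out[of q i] h_into[of q j] bounds assms by auto
    moreover have "between i q j" using ji assms by (auto simp: between_def)
    ultimately show ?thesis using bounds by blast
  next
    case False
    then obtain t where t: "t < 8" "t < r j \<or> r i < t" "(r i, t) \<in> arcs" "(t, r j) \<in> arcs"
      using arcs_backward[of "r j" "r i"] rji na role_less[of i] by auto
    obtain u where u: "u \<in> U" "r u = t" using role_rep t by blast
    have "u < j \<or> i < u" using role_mono[of j u] role_mono[of u i] u t by (meson leD leI)
    then have "between i u j" using ji by (auto simp: between_def)
    moreover have "r i \<noteq> t" "t \<noteq> r j" using t rji by auto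
    ultimately show ?thesis using u t h_inside[of i u] h_inside[of u j] assms U_less[OF u(1)] by auto
  qed
qed

lemma orientation_h: "orientation n h"
  unfolding orientation_def
proof (intro conjI allI impI)
  fix i assume "i < n"
  then show "h i (nxt n i)" by (rule h_side)
next
  fix i j assume "i < n" "j < n" "h i j"
  then show "\<not> h j i" by (rule h_antisym)
next
  fix i j l assume "i < n" "j < n" "l < n" "h i j \<and> h j l \<and> h l i"
  then show "\<not> between i j l" using h_acyclic by blast
next
  fix i j assume *: "i < n" "j < n" "i \<noteq> j \<and> j \<noteq> nxt n i"
  have "j \<noteq> Suc i" if "i \<in> U" using * that bounds by (auto simp: nxt_def)
  then show "h j i \<or> (\<exists>l<n. between i l j \<and> h i l \<and> h l j)"
    using h_apex_outside[of i j] h_apex_into[of i j] h_apex_out[of i j] h_apex_inside[of i j] * by blast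
qed

end

text \<open>
What the outside may rely on when a block is split repeatedly: arcs into the whole block survive,
and vertices unrelated to the block stay unrelated, except \<^term>\<open>k\<close>.
\<close>

definition extends :: "nat \<Rightarrow> (nat \<Rightarrow> nat \<Rightarrow> bool) \<Rightarrow> (nat \<Rightarrow> nat \<Rightarrow> bool) \<Rightarrow> nat \<Rightarrow> nat \<Rightarrow> nat \<Rightarrow> bool" where
  "extends n g h x m k \<longleftrightarrow>
     (\<forall>i j. i \<notin> {x..<x+m} \<and> j \<notin> {x..<x+m} \<longrightarrow> h i j = g i j) \<and>
     (\<forall>w<n. w \<notin> {x..<x+m} \<and> g w x \<longrightarrow> (\<forall>u\<in>{x..<x+m}. h w u)) \<and>
     (\<forall>w<n. w \<notin> {x..<x+m} \<and> w \<noteq> k \<and> \<not> g w x \<and> \<not> g x w \<longrightarrow> (\<forall>u\<in>{x..<x+m}. \<not> h w u \<and> \<not> h u w))"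

definition separated :: "(nat \<Rightarrow> nat \<Rightarrow> bool) \<Rightarrow> nat \<Rightarrow> nat \<Rightarrow> nat \<Rightarrow> nat \<Rightarrow> nat \<Rightarrow> nat \<Rightarrow> bool" where
  "separated g x m k y l k' \<longleftrightarrow>
     {x..<x+m} \<inter> {y..<y+l} = {} \<and> \<not> g x y \<and> \<not> g y x \<and> k \<notin> {y..<y+l} \<and> k' \<notin> {x..<x+m}"

text \<open>Chords between the two blocks are unoriented both before and after the first block is
  rewired, and nothing inside the second one changes. Exits of the second block that lead into the
  first one survive, because arcs into the whole first block are kept.\<close>

lemma leaf_extends:
  assumes U: "leaf n g x m k" and V: "leaf n g y l k'"
    and ext: "extends n g h x m k" and sep: "separated g x m k y l k'"
  shows "leaf n h y l k'"
proof -
  let ?U = "{x..<x+m}" and ?V = "{y..<y+l}"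
  have bU: "1 \<le> m" "x + m < n" and bV: "1 \<le> y" "1 \<le> l" "y + l < n" "k' < n" "k' \<notin> ?V"
    using U V unfolding leaf_def by blast+
  have disj: "?U \<inter> ?V = {}" and xy: "\<not> g x y" "\<not> g y x" and kV: "k \<notin> ?V" and kU: "k' \<notin> ?U"
    using sep by (auto simp: separated_def)
  have Ult: "u < n" if "u \<in> ?U" for u using that bU by auto
  have Vlt: "v < n" if "v \<in> ?V" for v using that bV by auto
  have xU: "x \<in> ?U" and yV: "y \<in> ?V" using bU bV by auto
  have twU: "g v u = g v x" "g u v = g x v" if "v < n" "v \<notin> ?U" "u \<in> ?U" for u v
    using leaf_twins[OF U that] .
  have twV: "g v u = g y u" "g u v = g u y" if "u < n" "u \<notin> ?V" "v \<in> ?V" for u v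
    using leaf_twins(2,1)[OF V that] .
  have gUV: "\<not> g u v \<and> \<not> g v u" if "u \<in> ?U" "v \<in> ?V" for u v
  proof -
    have "x \<notin> ?V" "v \<notin> ?U" using xU disj that by blast+
    then show ?thesis using twU[of v u] twV[of x v] xy that Vlt[of v] Ult[OF xU] by simp
  qed
  have agree: "h i j = g i j" if "i \<notin> ?U" "j \<notin> ?U" for i j
    using ext that by (auto simp: extends_def)
  have hUV: "\<not> h u v \<and> \<not> h v u" if "u \<in> ?U" "v \<in> ?V" for u v
  proof -
    have "v \<notin> ?U" "v \<noteq> k" using that disj kV by blast+
    then show ?thesis
      using ext gUV[OF xU that(2)] that Vlt[OF that(2)] unfolding extends_def by blast
  qed
  have into: "h w u" if "w < n" "w \<notin> ?U" "g w x" "u \<in> ?U" for w u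
    using ext that unfolding extends_def by blast
  have VU: "v \<notin> ?U" if "v \<in> ?V" for v using that disj by blast
  have sp: "g (y - 1) y" "g y (y + l)" "g (y + l) k'" "g k' (y - 1)" "\<not> g k' y" "\<not> g y k'"
    using leaf_special[OF V] .
  have pU: "y - 1 \<notin> ?U" and qU: "y + l \<notin> ?U"
    using gUV[of "y - 1" y] gUV[of "y + l" y] sp yV by blast+
  have short: "\<not> g w k'" if "w < n" "w \<notin> ?V" "w \<noteq> y + l" "g y w" "between y w k'" for w
    using leaf_no_short_return[OF V] that by blast
  have exit: "\<exists>w<n. w \<notin> ?V \<and> w \<noteq> y + l \<and> g y w \<and> g w v \<and> between y w v"
    if "v < n" "v \<notin> ?V" "\<not> g y v" "\<not> g v y" "v \<noteq> k'" for v
    using leaf_second_exit[OF V] that by blast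
  show ?thesis
    unfolding leaf_def
  proof (intro conjI allI impI ballI)
    show "1 \<le> y" "1 \<le> l" "y + l < n" "k' < n" "k' \<notin> ?V" by fact+
  next
    fix v u assume *: "v < n" "v \<notin> ?V" "u \<in> ?V"
    show "h v u = h v y"
      using agree[of v u] agree[of v y] twV[of v u] hUV[of v u] hUV[of v y] * VU[of u] VU[OF yV] yV
      by (cases "v \<in> ?U") simp_all
    show "h u v = h y v"
      using agree[of u v] agree[of y v] twV[of v u] hUV[of v u] hUV[of v y] * VU[of u] VU[OF yV] yV
      by (cases "v \<in> ?U") simp_all
  next
    fix u w assume "u \<in> ?V" "w \<in> ?V"
    then show "h u w = (u < w)" using leaf_clique[OF V] agree[of u w] VU[of u] VU[of w] by simp
  next
    show "h (y - 1) y" "h y (y + l)" "h (y + l) k'" "h k' (y - 1)" "\<not> h k' y" "\<not> h y k'"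
      using sp agree pU qU kU VU[OF yV] by blast+
  next
    fix w assume *: "w < n" "w \<notin> ?V \<and> w \<noteq> y + l \<and> h y w \<and> between y w k'"
    then have "w \<notin> ?U" using hUV[of w y] yV by blast
    then show "\<not> h w k'" using short[of w] * agree[of w k'] agree[of y w] kU VU[OF yV] by blast
  next
    fix v assume *: "v < n" "v \<notin> ?V \<and> \<not> h y v \<and> \<not> h v y \<and> v \<noteq> k'"
    have "\<not> g y v \<and> \<not> g v y"
      using * agree[of y v] agree[of v y] gUV[of v y] yV VU[OF yV] by blast
    then obtain w where w: "w < n" "w \<notin> ?V" "w \<noteq> y + l" "g y w" "g w v" "between y w v"
      using exit[of v] * by blast
    have wU: "w \<notin> ?U" using gUV[of w y] w yV by blast
    have "h w v"
    proof (cases "v \<in> ?U")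
      case True
      then show ?thesis using into[of w v] twU[of w v] w wU by blast
    next
      case False
      then show ?thesis using agree[of w v] w wU by blast
    qed
    then show "\<exists>w<n. w \<notin> ?V \<and> w \<noteq> y + l \<and> h y w \<and> h w v \<and> between y w v"
      using w agree[of y w] wU VU[OF yV] by blast
  qed
qed

section \<open>The two new blocks are leaves again\<close>

context refinement
begin

lemma role_iff:
  assumes "i \<in> U"
  shows "r i = 0 \<longleftrightarrow> i = x" "r i = 1 \<longleftrightarrow> i = x + 1" "r i = 2 \<longleftrightarrow> i \<in> {x+2..<x+2+m1}"
    "r i = 3 \<longleftrightarrow> i = x + 2 + m1" "r i = 4 \<longleftrightarrow> i = x + 3 + m1" "r i = 5 \<longleftrightarrow> i = x + 4 + m1"
    "r i = 6 \<longleftrightarrow> i \<in> {x+5+m1..<x+5+m1+m2}" "r i = 7 \<longleftrightarrow> i = x + 5 + m1 + m2"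
  using assms m1 m2 unfolding role_def by (simp_all; linarith)+

lemma role_values:
  "r x = 0" "r (x + 1) = 1" "r (x + 2) = 2" "r (x + 2 + m1) = 3" "r (x + 3 + m1) = 4" "r (x + 4 + m1) = 5"
  "r (x + 5 + m1) = 6" "r (x + 5 + m1 + m2) = 7"
  using m1 m2 by (simp_all add: role_def)

lemma left_role: "u \<in> {x+2..<x+2+m1} \<Longrightarrow> u \<in> U \<and> r u = 2"
  using role_iff(3)[of u] by auto

lemma right_role: "u \<in> {x+5+m1..<x+5+m1+m2} \<Longrightarrow> u \<in> U \<and> r u = 6"
  using role_iff(7)[of u] by auto

lemma h_extends: "extends n g h x m k"
  unfolding extends_def
proof (intro conjI allI impI ballI)
  fix i j assume "i \<notin> U \<and> j \<notin> U"
  then show "h i j = g i j" using h_outside by blast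
next
  fix w u assume "w < n" "w \<notin> U \<and> g w x" "u \<in> U"
  then show "h w u" using h_into_I by blast
next
  fix w u assume *: "w < n" "w \<notin> U \<and> w \<noteq> k \<and> \<not> g w x \<and> \<not> g x w" "u \<in> U"
  then have "w \<noteq> q" using special by auto
  then show "\<not> h w u" "\<not> h u w" using * h_into[of w u] h_out[of w u] by auto
qed

text \<open>The vertex \<open>k\<close> is reached through \<open>q\<close>, any other unrelated
  vertex through the second exit of the old block. Both leave the old block at once, so they avoid
  roles 3 and 7, the successors of the new blocks.\<close>

lemma exit_of_block:
  assumes "v < n" "v \<notin> U" "u \<in> U" "r u \<in> {2, 6}" "\<not> h u v" "\<not> h v u"
  shows "\<exists>w<n. w \<notin> U \<and> h u w \<and> h w v \<and> between u w v"
proof (cases "v = k")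
  case True
  have "h u q" using h_out[of q u] assms bounds by auto
  moreover have "h q k" using h_outside[of q k] special bounds by auto
  moreover have "between u q k" using bounds k_neq assms by (auto simp: between_def)
  ultimately show ?thesis using bounds True by (intro exI[of _ q]) auto
next
  case False
  have "v \<noteq> q" using h_out[of q u] assms bounds by auto
  then have "\<not> g x v" "\<not> g v x" using assms h_out[of v u] h_into[of v u] False by auto
  then obtain w where w: "w < n" "w \<notin> U" "w \<noteq> q" "g x w" "g w v" "between x w v"
    using second_exit[of v] assms False by blast
  have "between u w v" using between_shift[OF x_in_U assms(3) w(2) assms(2)] w(6) by blast
  moreover have "h u w" using h_out[of w u] w assms by auto
  moreover have "h w v" using h_outside w assms by blast
  ultimately show ?thesis using w by blast
qed

text \<open>Roles 1, 3 and 4 act as predecessor, successor and \<open>k\<close> of the new block.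
  The other unrelated roles are 0 and 6, both reached through role 5.\<close>

lemma leaf_left: "leaf n h (x + 2) m1 (x + 3 + m1)"
proof -
  let ?L = "{x+2..<x+2+m1}"
  have x2: "x + 2 \<in> U" "r (x + 2) = 2" using left_role[of "x + 2"] m1 by auto
  have twin: "h v u = h v (x + 2) \<and> h u v = h (x + 2) v" if "v < n" "v \<notin> ?L" "u \<in> ?L" for v u
  proof (cases "v \<in> U")
    case True
    then have "r v \<noteq> 2" using role_iff(3)[of v] that by blast
    then show ?thesis
      using h_inside[of v u] h_inside[of u v] h_inside[of v "x + 2"] h_inside[of "x + 2" v]
        True left_role[OF that(3)] x2 by auto
  next
    case False
    then show ?thesis
      using h_into[of v u] h_out[of v u] h_into[of v "x + 2"] h_out[of v "x + 2"] that
        left_role[OF that(3)] x2 by auto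
  qed
  show ?thesis
    unfolding leaf_def
  proof (intro conjI allI impI ballI)
    show "1 \<le> x + 2" "1 \<le> m1" "x + 2 + m1 < n" "x + 3 + m1 < n" "x + 3 + m1 \<notin> ?L"
      using m1 bounds by auto
  next
    fix v u assume "v < n" "v \<notin> ?L" "u \<in> ?L"
    then show "h v u = h v (x + 2)" "h u v = h (x + 2) v" using twin by blast+
  next
    fix u w assume "u \<in> ?L" "w \<in> ?L"
    then show "h u w = (u < w)" using left_role[of u] left_role[of w] h_inside[of u w] by auto
  next
    have "r (x + 2 - 1) = 1" using role_values(2) by simp
    then show "h (x + 2 - 1) (x + 2)" "h (x + 2) (x + 2 + m1)" "h (x + 2 + m1) (x + 3 + m1)"
      "h (x + 3 + m1) (x + 2 - 1)" "\<not> h (x + 3 + m1) (x + 2)" "\<not> h (x + 2) (x + 3 + m1)"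
      using role_values by (simp_all add: h_inside arcs_def)
  next
    fix w assume "w < n" "w \<notin> ?L \<and> w \<noteq> x + 2 + m1 \<and> h (x + 2) w \<and> between (x + 2) w (x + 3 + m1)"
    then show "\<not> h w (x + 3 + m1)" by (auto simp: between_def)
  next
    fix v assume *: "v < n" "v \<notin> ?L \<and> \<not> h (x + 2) v \<and> \<not> h v (x + 2) \<and> v \<noteq> x + 3 + m1"
    show "\<exists>w<n. w \<notin> ?L \<and> w \<noteq> x + 2 + m1 \<and> h (x + 2) w \<and> h w v \<and> between (x + 2) w v"
    proof (cases "v \<in> U")
      case True
      then have "r v \<noteq> 2" "r v \<noteq> 4" using role_iff(3,5)[of v] * by auto
      moreover have "(2, r v) \<notin> arcs" "(r v, 2) \<notin> arcs"
        using h_inside[of "x + 2" v] h_inside[of v "x + 2"] x2 True * \<open>r v \<noteq> 2\<close> by auto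
      moreover have "r v = 0 \<or> r v = 1 \<or> r v = 2 \<or> r v = 3 \<or> r v = 4 \<or> r v = 5 \<or> r v = 6 \<or> r v = 7"
        using role_less[of v] by linarith
      ultimately have rv: "r v = 0 \<or> r v = 6" by (auto simp: arcs_def)
      have c: "x + 4 + m1 \<in> U" by simp
      have "h (x + 2) (x + 4 + m1)" using h_inside x2 c role_values(6) by (auto simp: arcs_def)
      moreover have "h (x + 4 + m1) v"
        using h_inside[OF c True] role_values(6) rv by (auto simp: arcs_def)
      moreover have "between (x + 2) (x + 4 + m1) v"
        using rv role_iff(1,7)[OF True] by (auto simp: between_def)
      ultimately show ?thesis using bounds by (intro exI[of _ "x + 4 + m1"]) auto
    next
      case False
      obtain w where "w < n" "w \<notin> U" "h (x + 2) w" "h w v" "between (x + 2) w v"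
        using exit_of_block[of v "x + 2"] False x2 * by auto
      then show ?thesis by (intro exI[of _ w]) auto
    qed
  qed
qed

text \<open>Roles 5, 7 and 3 act as predecessor, successor and \<open>k\<close> of the new block.
  The other unrelated role is 2, reached through role 1. Besides role 7, role 6 points only to roles
  0 and 1 inside the old block, and neither of these points to role 3.\<close>

lemma leaf_right: "leaf n h (x + 5 + m1) m2 (x + 2 + m1)"
proof -
  let ?R = "{x+5+m1..<x+5+m1+m2}"
  let ?y = "x + 5 + m1"
  have y: "?y \<in> U" "r ?y = 6" using right_role[of ?y] m2 by auto
  have twin: "h v u = h v ?y \<and> h u v = h ?y v" if "v < n" "v \<notin> ?R" "u \<in> ?R" for v u
  proof (cases "v \<in> U")
    case True
    then have "r v \<noteq> 6" using role_iff(7)[of v] that by blast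
    then show ?thesis
      using h_inside[of v u] h_inside[of u v] h_inside[of v ?y] h_inside[of ?y v]
        True right_role[OF that(3)] y by auto
  next
    case False
    then show ?thesis
      using h_into[of v u] h_out[of v u] h_into[of v ?y] h_out[of v ?y] that
        right_role[OF that(3)] y by auto
  qed
  show ?thesis
    unfolding leaf_def
  proof (intro conjI allI impI ballI)
    show "1 \<le> ?y" "1 \<le> m2" "?y + m2 < n" "x + 2 + m1 < n" "x + 2 + m1 \<notin> ?R"
      using m2 bounds by auto
  next
    fix v u assume "v < n" "v \<notin> ?R" "u \<in> ?R"
    then show "h v u = h v ?y" "h u v = h ?y v" using twin by blast+
  next
    fix u w assume "u \<in> ?R" "w \<in> ?R"
    then show "h u w = (u < w)" using right_role[of u] right_role[of w] h_inside[of u w] by auto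
  next
    have "r (?y - 1) = 5" using role_values(6) by (simp add: role_def)
    then show "h (?y - 1) ?y" "h ?y (?y + m2)" "h (?y + m2) (x + 2 + m1)"
      "h (x + 2 + m1) (?y - 1)" "\<not> h (x + 2 + m1) ?y" "\<not> h ?y (x + 2 + m1)"
      using role_values by (simp_all add: h_inside arcs_def)
  next
    fix w assume *: "w < n" "w \<notin> ?R \<and> w \<noteq> ?y + m2 \<and> h ?y w \<and> between ?y w (x + 2 + m1)"
    have b: "x + 2 + m1 \<in> U" by simp
    show "\<not> h w (x + 2 + m1)"
    proof (cases "w \<in> U")
      case True
      then have "r w \<noteq> 6" "r w \<noteq> 7" using role_iff(7,8)[OF True] * by auto
      moreover have "(6, r w) \<in> arcs" using h_inside[OF y(1) True] y * \<open>r w \<noteq> 6\<close> by auto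
      ultimately have "r w = 0 \<or> r w = 1" by (auto simp: arcs_def)
      then show ?thesis using h_inside[OF True b] role_values(4) by (auto simp: arcs_def)
    next
      case False
      then have "g x w" using h_out[of w ?y] * y special by (auto split: if_splits)
      then have "\<not> g w x" "w \<noteq> k" using antisym[of x w] * bounds special by auto
      then show ?thesis using h_into[of w "x + 2 + m1"] False * b role_values(4) by auto
    qed
  next
    fix v assume *: "v < n" "v \<notin> ?R \<and> \<not> h ?y v \<and> \<not> h v ?y \<and> v \<noteq> x + 2 + m1"
    show "\<exists>w<n. w \<notin> ?R \<and> w \<noteq> ?y + m2 \<and> h ?y w \<and> h w v \<and> between ?y w v"
    proof (cases "v \<in> U")
      case True
      then have "r v \<noteq> 6" "r v \<noteq> 3" using role_iff(4,7)[of v] * by auto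
      moreover have "(6, r v) \<notin> arcs" "(r v, 6) \<notin> arcs"
        using h_inside[of ?y v] h_inside[of v ?y] y True * \<open>r v \<noteq> 6\<close> by auto
      moreover have "r v = 0 \<or> r v = 1 \<or> r v = 2 \<or> r v = 3 \<or> r v = 4 \<or> r v = 5 \<or> r v = 6 \<or> r v = 7"
        using role_less[of v] by linarith
      ultimately have rv: "r v = 2" by (auto simp: arcs_def)
      have e: "x + 1 \<in> U" by simp
      have "h ?y (x + 1)" using h_inside y e role_values(2) by (auto simp: arcs_def)
      moreover have "h (x + 1) v"
        using h_inside[OF e True] role_values(2) rv by (auto simp: arcs_def)
      moreover have "between ?y (x + 1) v"
        using rv role_iff(3)[OF True] by (auto simp: between_def)
      ultimately show ?thesis using bounds by (intro exI[of _ "x + 1"]) auto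
    next
      case False
      obtain w where "w < n" "w \<notin> U" "h ?y w" "h w v" "between ?y w v"
        using exit_of_block[of v ?y] False y * by auto
      then show ?thesis by (intro exI[of _ w]) auto
    qed
  qed
qed

lemma separated_left_right: "separated h (x + 2) m1 (x + 3 + m1) (x + 5 + m1) m2 (x + 2 + m1)"
  using m1 m2 role_values by (auto simp: separated_def h_inside arcs_def)

end

section \<open>Counting the unoriented chords\<close>

definition free_roles :: "(nat \<times> nat) set" where
  "free_roles = {(0,2),(1,3),(1,5),(2,4),(2,6),(3,6),(4,7),(5,7)}"

lemma free_roles_iff:
  assumes "s \<le> t" "t < 8"
  shows "s \<noteq> t \<and> (s, t) \<notin> arcs \<and> (t, s) \<notin> arcs \<longleftrightarrow> (s, t) \<in> free_roles"
proof -
  have "\<forall>s<8. \<forall>t<8. s \<le> t \<longrightarrow> (s \<noteq> t \<and> (s, t) \<notin> arcs \<and> (t, s) \<notin> arcs \<longleftrightarrow> (s, t) \<in> free_roles)"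
    unfolding all_less_8 by (simp add: arcs_def free_roles_def)
  then show ?thesis using assms by simp
qed

context refinement
begin

definition cls :: "nat \<Rightarrow> nat set" where "cls t = {i \<in> U. r i = t}"

lemma card_cls:
  "card (cls 0) = 1" "card (cls 1) = 1" "card (cls 2) = m1" "card (cls 3) = 1" "card (cls 4) = 1"
  "card (cls 5) = 1" "card (cls 6) = m2" "card (cls 7) = 1"
proof -
  have "cls 0 = {x}" "cls 1 = {x + 1}" "cls 3 = {x + 2 + m1}" "cls 4 = {x + 3 + m1}"
    "cls 5 = {x + 4 + m1}" "cls 7 = {x + 5 + m1 + m2}"
    unfolding cls_def using role_iff role_values by auto
  moreover have "cls 2 = {x+2..<x+2+m1}" "cls 6 = {x+5+m1..<x+5+m1+m2}"
    unfolding cls_def using role_iff(3,7) left_role right_role by blast+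
  ultimately show "card (cls 0) = 1" "card (cls 1) = 1" "card (cls 2) = m1" "card (cls 3) = 1"
    "card (cls 4) = 1" "card (cls 5) = 1" "card (cls 6) = m2" "card (cls 7) = 1"
    by simp_all
qed

lemma finite_cls: "finite (cls t)" by (simp add: cls_def)

lemma cls_disjoint: "s \<noteq> t \<Longrightarrow> cls s \<inter> cls t = {}" by (auto simp: cls_def)

definition gained :: "(nat \<times> nat) set" where
  "gained = (\<Union>p\<in>free_roles. cls (fst p) \<times> cls (snd p)) \<union> (cls 1 \<union> cls 4) \<times> {q}"

text \<open>The vertex \<open>k\<close> follows the block in \<open>leaf_left\<close> and precedes
  it in \<open>leaf_right\<close>; hence \<open>min\<close> and \<open>max\<close>.\<close>

definition lost :: "(nat \<times> nat) set" where
  "lost = (\<lambda>i. (min i k, max i k)) ` (cls 0 \<union> cls 1 \<union> cls 4)"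

text \<open>The main term \<open>m1 * m2\<close> comes from roles 2 and 6. The constant 6 counts
  four pairs of single vertices and the two chords from roles 1 and 4 to \<open>q\<close>.\<close>

lemma card_gained: "card gained = m1 * m2 + 2 * m1 + m2 + 6"
proof -
  have "card (\<Union>p\<in>free_roles. cls (fst p) \<times> cls (snd p)) = (\<Sum>p\<in>free_roles. card (cls (fst p) \<times> cls (snd p)))"
  proof (rule card_UN_disjoint)
    show "\<forall>p\<in>free_roles. \<forall>p'\<in>free_roles. p \<noteq> p' \<longrightarrow>
      (cls (fst p) \<times> cls (snd p)) \<inter> (cls (fst p') \<times> cls (snd p')) = {}"
      by (auto simp: cls_def)
  qed (auto simp: free_roles_def finite_cls)
  also have "\<dots> = m1 * m2 + 2 * m1 + m2 + 4"
    by (simp add: free_roles_def card_cartesian_product card_cls[unfolded One_nat_def])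
  finally have 1: "card (\<Union>p\<in>free_roles. cls (fst p) \<times> cls (snd p)) = m1 * m2 + 2 * m1 + m2 + 4" .
  have 2: "card ((cls 1 \<union> cls 4) \<times> {q}) = 2"
    using card_Un_disjoint[OF finite_cls finite_cls cls_disjoint, of 1 4] card_cls
    by (simp add: card_cartesian_product)
  have "(\<Union>p\<in>free_roles. cls (fst p) \<times> cls (snd p)) \<inter> (cls 1 \<union> cls 4) \<times> {q} = {}"
    by (auto simp: cls_def)
  then show ?thesis
    unfolding gained_def using 1 2 by (subst card_Un_disjoint) (auto simp: finite_cls free_roles_def)
qed

lemma card_lost: "card lost = 3"
proof -
  have "inj_on (\<lambda>i. (min i k, max i k)) (cls 0 \<union> cls 1 \<union> cls 4)"
    by (rule inj_onI) (auto simp: min_def max_def split: if_splits)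
  moreover have "card (cls 0 \<union> cls 1 \<union> cls 4) = 3"
    using card_cls by (subst card_Un_disjoint | simp add: finite_cls Int_Un_distrib2 cls_disjoint)+
  ultimately show ?thesis unfolding lost_def by (simp add: card_image)
qed

lemma block_arcs:
  assumes "u \<in> U"
  shows "w \<in> U \<Longrightarrow> g u w \<longleftrightarrow> u < w" "\<not> g k u" "\<not> g u k" "g u q"
proof -
  show "w \<in> U \<Longrightarrow> g u w \<longleftrightarrow> u < w" by (rule leaf_clique[OF leaf_g assms])
  show "\<not> g k u" "\<not> g u k" "g u q"
    using twins[OF bounds(3,4) assms] twins(2)[of q, OF bounds(2) _ assms] special by simp_all
qed

lemma lost_subset: "lost \<subseteq> unoriented n g"
proof
  fix p assume "p \<in> lost"
  then obtain i where i: "i \<in> U" "p = (min i k, max i k)" by (auto simp: lost_def cls_def)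
  then have "i \<noteq> k" "i < n" using bounds U_less[of i] by auto
  then show "p \<in> unoriented n g" using i block_arcs(2,3)[OF i(1)] bounds
    by (auto simp: unoriented_def min_def max_def)
qed

lemma gained_disjoint: "gained \<inter> unoriented n g = {}"
proof -
  have "(i, j) \<notin> unoriented n g" if "(i, j) \<in> gained" for i j
  proof -
    have "i \<in> U" "j \<in> U \<or> j = q" using that by (auto simp: gained_def cls_def)
    then show ?thesis using block_arcs(1)[of i j] block_arcs(4)[of i] by (auto simp: unoriented_def)
  qed
  then show ?thesis by auto
qed

lemma unoriented_refine: "unoriented n h = (unoriented n g - lost) \<union> gained"
proof (rule set_eqI)
  fix p :: "nat \<times> nat"
  obtain i j where p: "p = (i, j)" by (cases p)
  have gained_iff: "(i, j) \<in> gained \<longleftrightarrow> i \<in> U \<and> (j \<in> U \<and> (r i, r j) \<in> free_roles \<or> j = q \<and> r i \<in> {1, 4})"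
  proof -
    have "(i, j) \<in> (\<Union>p\<in>free_roles. cls (fst p) \<times> cls (snd p)) \<longleftrightarrow>
        i \<in> U \<and> j \<in> U \<and> (r i, r j) \<in> free_roles"
      unfolding cls_def by force
    then show ?thesis unfolding gained_def by (auto simp: cls_def)
  qed
  have lost_iff: "(i, j) \<in> lost \<longleftrightarrow> i < j \<and> (i = k \<and> j \<in> U \<and> r j \<in> {0,1,4} \<or> j = k \<and> i \<in> U \<and> r i \<in> {0,1,4})"
  proof -
    have "(i, j) \<in> lost \<longleftrightarrow> (\<exists>u\<in>U. r u \<in> {0,1,4} \<and> i = min u k \<and> j = max u k)"
    proof -
      have "cls 0 \<union> cls 1 \<union> cls 4 = {u \<in> U. r u \<in> {0,1,4}}" by (auto simp: cls_def)
      then show ?thesis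
        by (simp only: lost_def image_iff mem_Collect_eq Bex_def prod.inject conj_assoc)
    qed
    also have "\<dots> \<longleftrightarrow> (\<exists>u\<in>U. r u \<in> {0,1,4} \<and> i < j \<and> (i = k \<and> j = u \<or> j = k \<and> i = u))"
    proof (rule bex_cong[OF refl])
      fix u assume "u \<in> U"
      then have "u \<noteq> k" using bounds(4) by auto
      then have "i = min u k \<and> j = max u k \<longleftrightarrow> i < j \<and> (i = k \<and> j = u \<or> j = k \<and> i = u)"
        by (cases "u < k") auto
      then show "(r u \<in> {0,1,4} \<and> i = min u k \<and> j = max u k) \<longleftrightarrow>
          (r u \<in> {0,1,4} \<and> i < j \<and> (i = k \<and> j = u \<or> j = k \<and> i = u))" by blast
    qed
    finally show ?thesis by blast
  qed
  have "(i, j) \<in> unoriented n h \<longleftrightarrow> (i, j) \<in> unoriented n g \<and> (i, j) \<notin> lost \<or> (i, j) \<in> gained"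
  proof (cases "i < j \<and> j < n")
    case False
    have "(i, j) \<notin> gained"
    proof
      assume "(i, j) \<in> gained"
      then have ij: "i \<in> U" "j \<in> U \<and> (r i, r j) \<in> free_roles \<or> j = q" using gained_iff by auto
      \<comment> \<open>Free pairs list the smaller role first, and roles are monotone.\<close>
      moreover have "i < j" if "j \<in> U" "(r i, r j) \<in> free_roles"
      proof -
        have "r i < r j" using that(2) by (auto simp: free_roles_def)
        then show ?thesis using role_mono[of j i] by (cases "i < j") auto
      qed
      ultimately show False using False bounds by auto
    qed
    then show ?thesis using False by (auto simp: unoriented_def)
  next
    case True
    then have ij: "i < j" "j < n" "i < n" by auto
    have un: "(i, j) \<in> unoriented n f \<longleftrightarrow> \<not> f i j \<and> \<not> f j i" for f
      using ij by (auto simp: unoriented_def)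
    consider "i \<in> U" "j \<in> U" | "i \<in> U" "j \<notin> U" | "i \<notin> U" "j \<in> U" | "i \<notin> U" "j \<notin> U" by blast
    then show ?thesis
    proof cases
      case 1
      have "r i \<le> r j" using role_mono ij by simp
      have "(i, j) \<in> unoriented n h \<longleftrightarrow> r i \<noteq> r j \<and> (r i, r j) \<notin> arcs \<and> (r j, r i) \<notin> arcs"
        unfolding un h_inside[OF 1] h_inside[OF 1(2,1)] using ij(1) by (cases "r i = r j") simp_all
      also have "\<dots> \<longleftrightarrow> (r i, r j) \<in> free_roles"
        by (rule free_roles_iff[OF \<open>r i \<le> r j\<close> role_less])
      finally have "(i, j) \<in> unoriented n h \<longleftrightarrow> (r i, r j) \<in> free_roles" .
      moreover have "j \<noteq> q" using 1 by auto
      ultimately show ?thesis using 1 un[of g] block_arcs(1)[OF 1] gained_iff ij(1) by blast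
    next
      case 2
      have gx: "g j i = g j x" "g i j = g x j" using twins[OF ij(2) 2(2,1)] .
      have ho: "h i j = (if j = q then r i \<in> {2,3,5,6,7} else g x j)"
        and hi: "h j i = (if j = q then r i = 0 else if j = k then r i \<in> {0,1,4} else g j x)"
        using h_out[OF ij(2) 2(2,1)] h_into[OF ij(2) 2(2,1)] .
      have ga: "(i, j) \<in> gained \<longleftrightarrow> j = q \<and> r i \<in> {1,4}" using gained_iff 2 by blast
      have lo: "(i, j) \<in> lost \<longleftrightarrow> j = k \<and> r i \<in> {0,1,4}" using lost_iff 2 ij(1) by blast
      consider "j = q" | "j = k" | "j \<noteq> q" "j \<noteq> k" by blast
      then show ?thesis
      proof cases
        case 1
        have "r i \<notin> {2,3,5,6,7} \<and> r i \<noteq> 0 \<longleftrightarrow> r i \<in> {1,4}"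
          using less_8[OF role_less[of i]] by auto
        then show ?thesis using un ho hi ga lo 1 block_arcs(4)[OF 2(1)] by simp
      next
        case 2
        then show ?thesis using un ho hi gx ga lo k_neq(1) special(5,6) by simp
      next
        case 3
        then show ?thesis using un ho hi gx ga lo by simp
      qed
    next
      case 3
      have gx: "g i j = g i x" "g j i = g x i" using twins[OF ij(3) 3] .
      have nq: "i \<noteq> q" using 3 ij(1) by auto
      have ho: "h j i = g x i"
        and hi: "h i j = (if i = k then r j \<in> {0,1,4} else g i x)"
        using h_out[OF ij(3) 3] h_into[OF ij(3) 3] nq by simp_all
      have ga: "(i, j) \<notin> gained" using gained_iff 3 by blast
      have lo: "(i, j) \<in> lost \<longleftrightarrow> i = k \<and> r j \<in> {0,1,4}" using lost_iff 3 ij(1) by blast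
      show ?thesis using un ho hi gx ga lo special(5,6) by (cases "i = k") simp_all
    next
      case 4
      then show ?thesis using un h_outside gained_iff lost_iff by auto
    qed
  qed
  then show "p \<in> unoriented n h \<longleftrightarrow> p \<in> (unoriented n g - lost) \<union> gained" using p by blast
qed

lemma card_unoriented_refine:
  "card (unoriented n h) = card (unoriented n g) + m1 * m2 + 2 * m1 + m2 + 3"
proof -
  have fin: "finite (unoriented n g)"
    by (rule finite_subset[of _ "{..<n} \<times> {..<n}"]) (auto simp: unoriented_def)
  have fin': "finite gained" "finite lost"
    unfolding gained_def lost_def by (auto simp: free_roles_def finite_cls)
  have "card (unoriented n h) = card (unoriented n g - lost) + card gained"
    unfolding unoriented_refine using fin fin' gained_disjoint by (subst card_Un_disjoint) auto
  also have "card (unoriented n g - lost) = card (unoriented n g) - 3"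
    using card_Diff_subset[OF fin'(2) lost_subset] card_lost by simp
  also have "card (unoriented n g) \<ge> 3"
    using card_mono[OF fin lost_subset] card_lost by simp
  ultimately show ?thesis using card_gained by simp
qed

end

fun gain :: "nat \<Rightarrow> nat \<Rightarrow> nat" where
  "gain 0 m = 0"
| "gain (Suc d) m = (let m1 = (m - 6) div 2; m2 = m - 6 - m1 in
     m1 * m2 + 2 * m1 + m2 + 3 + gain d m1 + gain d m2)"

text \<open>For \<^term>\<open>m < 6\<close> the truncated subtraction makes \<^term>\<open>gain (Suc d) m\<close> a junk value.\<close>

lemma iterated_refinement:
  "orientation n g \<Longrightarrow> leaf n g x m k \<Longrightarrow> 7 * 2 ^ d \<le> m + 6 \<Longrightarrow>
    \<exists>h. orientation n h \<and> extends n g h x m k \<and> card (unoriented n h) = card (unoriented n g) + gain d m"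
proof (induction d arbitrary: g x m k)
  case 0
  have "extends n g g x m k"
    unfolding extends_def
  proof (intro conjI allI impI ballI)
    fix w u assume "w < n" "w \<notin> {x..<x+m} \<and> g w x" "u \<in> {x..<x+m}"
    then show "g w u" using leaf_twins(1)[OF 0(2), of w u] by blast
  next
    fix w u assume "w < n" "w \<notin> {x..<x+m} \<and> w \<noteq> k \<and> \<not> g w x \<and> \<not> g x w" "u \<in> {x..<x+m}"
    then show "\<not> g w u" "\<not> g u w" using leaf_twins[OF 0(2), of w u] by blast+
  qed blast
  then show ?case using 0 by auto
next
  case (Suc d)
  define m1 where "m1 = (m - 6) div 2"
  define m2 where "m2 = m - 6 - m1"
  have pos: "1 \<le> (2::nat) ^ d" by simp
  have b: "14 * 2 ^ d \<le> m + 6" using Suc.prems(3) by simp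
  then have m6: "8 \<le> m" using pos by linarith
  have sizes: "7 * 2 ^ d \<le> m1 + 6" "7 * 2 ^ d \<le> m2 + 6" and m: "m = m1 + m2 + 6"
    using b m6 by (auto simp: m1_def m2_def)
  have m12: "1 \<le> m1" "1 \<le> m2" using sizes pos by linarith+
  interpret refinement n g x m1 m2 k
    using Suc.prems m m12 by unfold_locales auto
  let ?h = "refine g x m1 m2 k"
  let ?L = "{x+2..<x+2+m1}" and ?R = "{x+5+m1..<x+5+m1+m2}" and ?U = "{x..<x+(m1+m2+6)}"
  obtain g2 where g2: "orientation n g2" "extends n ?h g2 (x + 2) m1 (x + 3 + m1)"
      "card (unoriented n g2) = card (unoriented n ?h) + gain d m1"
    using Suc.IH[OF orientation_h leaf_left sizes(1)] by blast
  have "leaf n g2 (x + 5 + m1) m2 (x + 2 + m1)"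
    using leaf_extends[OF leaf_left leaf_right g2(2) separated_left_right] .
  then obtain g3 where g3: "orientation n g3" "extends n g2 g3 (x + 5 + m1) m2 (x + 2 + m1)"
      "card (unoriented n g3) = card (unoriented n g2) + gain d m2"
    using Suc.IH[OF g2(1) _ sizes(2)] by blast
  have LU: "?L \<subseteq> ?U" "?R \<subseteq> ?U" "?L \<inter> ?R = {}" by auto
  have L0: "x + 2 \<in> ?L" "x + 5 + m1 \<in> ?R" using m12 by auto
  have eq2: "g2 i j = ?h i j" if "i \<notin> ?L" "j \<notin> ?L" for i j
    using g2(2) that unfolding extends_def by blast
  have eq3: "g3 i j = g2 i j" if "i \<notin> ?R" "j \<notin> ?R" for i j
    using g3(2) that unfolding extends_def by blast
  have "extends n g g3 x (m1 + m2 + 6) k"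
    unfolding extends_def
  proof (intro conjI allI impI ballI)
    fix i j assume "i \<notin> ?U \<and> j \<notin> ?U"
    then have "i \<notin> ?L" "j \<notin> ?L" "i \<notin> ?R" "j \<notin> ?R" using LU by blast+
    then show "g3 i j = g i j"
      using eq2 eq3 h_outside \<open>i \<notin> ?U \<and> j \<notin> ?U\<close> by simp
  next
    fix w u assume w: "w < n" "w \<notin> ?U \<and> g w x" and u: "u \<in> ?U"
    have wn: "w \<notin> ?L" "w \<notin> ?R" using w LU by blast+
    have hw: "?h w v" if "v \<in> ?U" for v using h_into_I[of w v] w that by blast
    have g2w: "g2 w v" if "v \<in> ?U" for v
    proof (cases "v \<in> ?L")
      case True
      have "?h w (x + 2)" using hw L0(1) LU(1) by blast
      then show ?thesis using g2(2) w(1) wn True unfolding extends_def by blast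
    next
      case False
      then show ?thesis using eq2[of w v] hw[OF that] wn by blast
    qed
    show "g3 w u"
    proof (cases "u \<in> ?R")
      case True
      have "g2 w (x + 5 + m1)" using g2w L0(2) LU(2) by blast
      then show ?thesis using g3(2) w(1) wn True unfolding extends_def by blast
    next
      case False
      then show ?thesis using eq3[of w u] g2w[OF u] wn by blast
    qed
  next
    fix w u assume w: "w < n" "w \<notin> ?U \<and> w \<noteq> k \<and> \<not> g w x \<and> \<not> g x w" and u: "u \<in> ?U"
    \<comment> \<open>The vertices playing \<open>k\<close> for the two inner blocks lie in the old
      block, so no outside vertex falls under their exemption in \<open>extends\<close>.\<close>
    have wn: "w \<notin> ?L" "w \<notin> ?R" "w \<noteq> x + 3 + m1" "w \<noteq> x + 2 + m1" using w LU by auto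
    have hw: "\<not> ?h w v \<and> \<not> ?h v w" if "v \<in> ?U" for v
      using h_extends w that unfolding extends_def by blast
    have g2w: "\<not> g2 w v \<and> \<not> g2 v w" if "v \<in> ?U" for v
    proof (cases "v \<in> ?L")
      case True
      have "\<not> ?h w (x + 2) \<and> \<not> ?h (x + 2) w" using hw L0(1) LU(1) by blast
      then show ?thesis using g2(2) w(1) wn True unfolding extends_def by blast
    next
      case False
      then show ?thesis using eq2[of w v] eq2[of v w] hw[OF that] wn by blast
    qed
    have "\<not> g3 w u \<and> \<not> g3 u w"
    proof (cases "u \<in> ?R")
      case True
      have "\<not> g2 w (x + 5 + m1) \<and> \<not> g2 (x + 5 + m1) w" using g2w L0(2) LU(2) by blast
      then show ?thesis using g3(2) w(1) wn True unfolding extends_def by blast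
    next
      case False
      then show ?thesis using eq3[of w u] eq3[of u w] g2w[OF u] wn by blast
    qed
    then show "\<not> g3 w u" "\<not> g3 u w" by blast+
  qed
  moreover have "card (unoriented n g3) = card (unoriented n g) + gain (Suc d) m"
  proof -
    have "gain (Suc d) m = m1 * m2 + 2 * m1 + m2 + 3 + gain d m1 + gain d m2"
      unfolding gain.simps Let_def m1_def m2_def ..
    then show ?thesis using g3(3) g2(3) card_unoriented_refine by linarith
  qed
  ultimately show ?case using g3(1) m by blast
qed

section \<open>The hub configuration and the range of sizes\<close>

text \<open>Vertex 0 is the hub, \<open>S\<close> marks the sources that it points to and
  \<open>T\<close> the sinks that point to it. The unoriented chords join a source to a later sink,
  or the hub to a vertex of neither kind.\<close>

definition hub :: "(nat \<Rightarrow> bool) \<Rightarrow> (nat \<Rightarrow> bool) \<Rightarrow> nat \<Rightarrow> nat \<Rightarrow> bool" where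
  "hub S T x y \<longleftrightarrow> (if x = 0 then y \<noteq> 0 \<and> S y else if y = 0 then T x else x < y \<and> \<not> (S x \<and> T y))"

text \<open>Arcs avoiding the hub increase, so a clockwise directed triangle passes through the hub
  and would need an arc from a source to a later sink. Between such a pair the first non-source is
  no sink either, by \<open>gap\<close>, and serves as apex.\<close>

lemma orientation_hub:
  assumes n: "3 \<le> n" and ends: "S 1" "T (n - 1)" and disj: "\<And>x. S x \<Longrightarrow> \<not> T x"
    and gap: "\<And>x. S x \<Longrightarrow> \<not> T (Suc x)"
  shows "orientation n (hub S T)"
  unfolding orientation_def
proof (intro conjI allI impI)
  fix i assume "i < n"
  then show "hub S T i (nxt n i)"
    using n ends gap[of i] by (cases "i = n - 1") (auto simp: hub_def nxt_def)
next
  fix i j assume "i < n" "j < n" "hub S T i j"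
  then show "\<not> hub S T j i" using disj[of i] disj[of j] by (auto simp: hub_def split: if_splits)
next
  fix i j l assume "i < n" "j < n" "l < n" "hub S T i j \<and> hub S T j l \<and> hub S T l i"
  then show "\<not> between i j l" by (auto simp: hub_def between_def split: if_splits)
next
  fix i j assume ij: "i < n" "j < n" "i \<noteq> j \<and> j \<noteq> nxt n i"
  consider "i = 0" "T j" | "i = 0" "\<not> T j" | "j = 0" "S i" | "j = 0" "\<not> S i"
    | "0 < i" "i < j" "S i" "T j" | "0 < i" "i < j" "\<not> T j" | "0 < i" "i < j" "\<not> S i" "T j"
    | "0 < j" "j < i" "S j" "T i" | "0 < j" "j < i" "\<not> (S j \<and> T i)"
    using ij by (metis linorder_neqE_nat not_gr0)
  then show "hub S T j i \<or> (\<exists>l<n. between i l j \<and> hub S T i l \<and> hub S T l j)"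
  proof cases
    case 1
    then show ?thesis using ij by (auto simp: hub_def)
  next
    case 2
    then have "hub S T 0 1 \<and> hub S T 1 j \<and> between 0 1 j"
      using ij n ends by (auto simp: hub_def between_def nxt_def)
    then show ?thesis using 2 n by (intro disjI2 exI[of _ 1]) auto
  next
    case 3
    then show ?thesis using ij by (auto simp: hub_def)
  next
    case 4
    then have "hub S T i (n - 1) \<and> hub S T (n - 1) 0 \<and> between i (n - 1) 0"
      using ij n ends by (auto simp: hub_def between_def nxt_def split: if_splits)
    then show ?thesis using 4 n by (intro disjI2 exI[of _ "n - 1"]) auto
  next
    case 5
    define l where "l = (LEAST l. i < l \<and> \<not> S l)"
    have "i < j \<and> \<not> S j" using 5 disj by blast
    then have l: "i < l" "\<not> S l" "l \<le> j"
      unfolding l_def using LeastI[of "\<lambda>l. i < l \<and> \<not> S l" j] Least_le[of "\<lambda>l. i < l \<and> \<not> S l" j] by blast+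
    have "S (l - 1)"
    proof (cases "l - 1 = i")
      case False
      then have "i < l - 1" "l - 1 < l" using l by auto
      then show ?thesis using not_less_Least[of "l - 1" "\<lambda>l. i < l \<and> \<not> S l"] unfolding l_def by blast
    qed (use 5 in simp)
    then have "\<not> T l" using gap[of "l - 1"] l by simp
    then have "l \<noteq> j" using 5 by blast
    then have "l < n \<and> between i l j \<and> hub S T i l \<and> hub S T l j"
      using l 5 ij \<open>\<not> T l\<close> by (auto simp: hub_def between_def)
    then show ?thesis by blast
  next
    case 6
    then have S: "Suc i < j" using ij by (auto simp: nxt_def split: if_splits)
    then have "Suc i < n \<and> between i (Suc i) j \<and> hub S T i (Suc i) \<and> hub S T (Suc i) j"
      using 6 ij gap[of i] by (auto simp: hub_def between_def)
    then show ?thesis by blast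
  next
    case 7
    then have S: "i < j - 1" using ij by (auto simp: nxt_def split: if_splits)
    have "\<not> S (j - 1)" using gap[of "j - 1"] 7 by auto
    then have "j - 1 < n \<and> between i (j - 1) j \<and> hub S T i (j - 1) \<and> hub S T (j - 1) j"
      using 7 ij S by (auto simp: hub_def between_def)
    then show ?thesis by blast
  next
    case 8
    then have "0 < n \<and> between i 0 j \<and> hub S T i 0 \<and> hub S T 0 j"
      using ij by (auto simp: hub_def between_def)
    then show ?thesis by blast
  next
    case 9
    then show ?thesis by (auto simp: hub_def)
  qed
qed

context
  fixes n a j :: nat
  assumes a: "1 \<le> a" and j: "1 \<le> j" and n: "a + j + 6 \<le> n"
begin

text \<open>Clockwise from the hub come the block of \<open>a\<close> sources, a neutral vertex, the
  sink \<open>a + 2\<close> serving as \<open>k\<close>, a neutral vertex, a possibly empty run of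
  sinks, one extra source, a neutral vertex and \<open>j\<close> sinks. The extra source contributes
  exactly \<open>j\<close> chords, which makes \<open>j\<close> the free parameter.\<close>

definition source :: "nat \<Rightarrow> bool" where
  "source y \<longleftrightarrow> 1 \<le> y \<and> y \<le> a \<or> y = n - 2 - j"

definition sink :: "nat \<Rightarrow> bool" where
  "sink y \<longleftrightarrow> y = a + 2 \<or> a + 4 \<le> y \<and> y < n - 2 - j \<or> n - j \<le> y \<and> y < n"

lemma orientation_base: "orientation n (hub source sink)"
proof (rule orientation_hub)
  show "3 \<le> n" "source 1" "sink (n - 1)" using a j n by (auto simp: source_def sink_def)
  show "\<not> sink x" if "source x" for x using that a j n by (auto simp: source_def sink_def)
  show "\<not> sink (Suc x)" if "source x" for x using that a j n by (auto simp: source_def sink_def)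
qed

text \<open>The hub is the predecessor of the block. Any sink other than \<open>a + 2\<close> lies
  beyond the neutral vertex \<open>a + 3\<close>, which is therefore the second exit.\<close>

lemma leaf_base: "leaf n (hub source sink) 1 a (a + 2)"
  unfolding leaf_def
proof (intro conjI allI impI ballI)
  show "1 \<le> (1::nat)" "1 \<le> a" "1 + a < n" "a + 2 < n" "a + 2 \<notin> {1..<1+a}" using a n by auto
next
  fix v u assume "v < n" "v \<notin> {1..<1+a}" "u \<in> {1..<1+a}"
  then show "hub source sink v u = hub source sink v 1" "hub source sink u v = hub source sink 1 v"
    using a n by (auto simp: hub_def source_def sink_def)
next
  fix u w assume "u \<in> {1..<1+a}" "w \<in> {1..<1+a}"
  then show "hub source sink u w = (u < w)" using n by (auto simp: hub_def source_def sink_def)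
next
  show "hub source sink (1 - 1) 1" "hub source sink 1 (1 + a)" "hub source sink (1 + a) (a + 2)"
    "hub source sink (a + 2) (1 - 1)" "\<not> hub source sink (a + 2) 1" "\<not> hub source sink 1 (a + 2)"
    using a n by (auto simp: hub_def source_def sink_def)
next
  fix w assume "w < n" "w \<notin> {1..<1+a} \<and> w \<noteq> 1 + a \<and> hub source sink 1 w \<and> between 1 w (a + 2)"
  then show "\<not> hub source sink w (a + 2)" by (auto simp: between_def)
next
  fix v assume v: "v < n" "v \<notin> {1..<1+a} \<and> \<not> hub source sink 1 v \<and> \<not> hub source sink v 1 \<and> v \<noteq> a + 2"
  then have "sink v" "v \<noteq> 0" using a by (auto simp: hub_def source_def split: if_splits)
  then have "a + 3 < v" using v n by (auto simp: sink_def)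
  then show "\<exists>w<n. w \<notin> {1..<1+a} \<and> w \<noteq> 1 + a \<and> hub source sink 1 w \<and> hub source sink w v \<and> between 1 w v"
    using v a n j by (intro exI[of _ "a + 3"]) (auto simp: hub_def source_def sink_def between_def)
qed

text \<open>Each source of the block is paired with all \<open>n - 5 - a\<close> sinks, the extra
  source with the last \<open>j\<close>. The remaining 3 are the chords from the hub to the neutral
  vertices.\<close>

lemma card_base: "card (unoriented n (hub source sink)) = a * (n - 5 - a) + j + 3"
proof -
  \<comment> \<open>The length \<open>i\<close> of the middle run of sinks replaces the truncated
    subtractions.\<close>
  obtain i where n_eq: "n = a + i + j + 6" using n by (metis add.assoc add.commute le_Suc_ex)
  have src: "source y \<longleftrightarrow> 1 \<le> y \<and> y \<le> a \<or> y = a + i + 4" for y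
    unfolding source_def using n_eq by auto
  have snk: "sink y \<longleftrightarrow> y = a + 2 \<or> a + 4 \<le> y \<and> y < a + i + 4 \<or> a + i + 6 \<le> y \<and> y < n" for y
    unfolding sink_def using n_eq by auto
  let ?N = "{a+1, a+3, a+i+5}" and ?T = "insert (a+2) ({a+4..<a+i+4} \<union> {a+i+6..<n})"
  have eq: "unoriented n (hub source sink) =
      {0} \<times> ?N \<union> ({1..a} \<times> ?T \<union> {a+i+4} \<times> {a+i+6..<n})"
  proof (rule set_eqI)
    fix p :: "nat \<times> nat"
    obtain x y where p: "p = (x, y)" by (cases p)
    have "(x, y) \<in> unoriented n (hub source sink) \<longleftrightarrow>
        x < y \<and> y < n \<and> (if x = 0 then \<not> source y \<and> \<not> sink y else source x \<and> sink y)"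
      unfolding unoriented_def hub_def by auto
    also have "\<dots> \<longleftrightarrow> x = 0 \<and> y \<in> ?N \<or> x \<in> {1..a} \<and> y \<in> ?T \<or> x = a + i + 4 \<and> y \<in> {a+i+6..<n}"
    proof (cases "x = 0")
      case True
      then show ?thesis unfolding src snk using n_eq j by auto
    next
      case False
      then show ?thesis unfolding src snk using n_eq by auto
    qed
    finally show "p \<in> unoriented n (hub source sink) \<longleftrightarrow>
        p \<in> {0} \<times> ?N \<union> ({1..a} \<times> ?T \<union> {a+i+4} \<times> {a+i+6..<n})"
      using p by auto
  qed
  have "card ({a+4..<a+i+4} \<union> {a+i+6..<n}) = i + j"
    using n_eq by (subst card_Un_disjoint) auto
  then have "card ?T = n - 5 - a" using n_eq by simp
  then have "card ({1..a} \<times> ?T) = a * (n - 5 - a)" by (simp only: card_cartesian_product card_atLeastAtMost) simp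
  moreover have "card ({a+i+4} \<times> {a+i+6..<n}) = j" using n_eq by (simp add: card_cartesian_product)
  moreover have "({1..a} \<times> ?T) \<inter> ({a+i+4} \<times> {a+i+6..<n}) = {}" by auto
  ultimately have "card ({1..a} \<times> ?T \<union> {a+i+4} \<times> {a+i+6..<n}) = a * (n - 5 - a) + j"
    by (simp only: card_Un_disjoint finite_cartesian_product finite_insert finite_Un finite_atLeastLessThan
        finite_atLeastAtMost finite.emptyI)
  moreover have "card ({0} \<times> ?N) = 3" by (simp add: card_cartesian_product)
  moreover have "({0} \<times> ?N) \<inter> ({1..a} \<times> ?T \<union> {a+i+4} \<times> {a+i+6..<n}) = {}" by auto
  ultimately show ?thesis unfolding eq by (subst card_Un_disjoint) auto
qed

lemma nk_blocker_exists:
  assumes "7 * 2 ^ d \<le> a + 6"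
  shows "\<exists>B. nk_blocker n (a * (n - 5 - a) + gain d a + j + 3) B"
proof -
  obtain h where h: "orientation n h" "card (unoriented n h) = card (unoriented n (hub source sink)) + gain d a"
    using iterated_refinement[OF orientation_base leaf_base assms] by blast
  have "finite (unoriented n h)"
    by (rule finite_subset[of _ "{..<n} \<times> {..<n}"]) (auto simp: unoriented_def)
  moreover have "saturated_blocker n (unoriented n h)"
    using saturated_unoriented[OF h(1)] n by simp
  ultimately show ?thesis using h(2) card_base by (auto simp: nk_blocker_def intro!: exI[of _ "unoriented n h"])
qed

end

section \<open>Bounds on the gain, and coverage of all sizes\<close>

lemma gain_Suc: "gain d (Suc m) \<le> gain d m + m"
proof (induction d arbitrary: m)
  case (Suc d)
  define m1 m2 where "m1 = (m - 6) div 2" and "m2 = m - 6 - m1"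
  have g0: "gain (Suc d) m = m1 * m2 + 2 * m1 + m2 + 3 + gain d m1 + gain d m2"
    unfolding gain.simps Let_def m1_def m2_def ..
  define k1 k2 where "k1 = (Suc m - 6) div 2" and "k2 = Suc m - 6 - k1"
  have g1: "gain (Suc d) (Suc m) = k1 * k2 + 2 * k1 + k2 + 3 + gain d k1 + gain d k2"
    unfolding gain.simps Let_def k1_def k2_def ..
  \<comment> \<open>Raising \<open>m\<close> by one raises only one half. With the induction
    hypothesis the increase is at most \<open>m2 + 2 + m1\<close> if \<open>m1\<close> grows and
    \<open>m1 + 1 + m2\<close> if \<open>m2\<close> does; both are below \<open>m\<close>. For
    \<open>m < 6\<close> neither half changes.\<close>
  have "m < 6 \<and> k1 = m1 \<and> k2 = m2 \<or> m = m1 + m2 + 6 \<and> (k1 = Suc m1 \<and> k2 = m2 \<or> k1 = m1 \<and> k2 = Suc m2)"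
    unfolding m1_def m2_def k1_def k2_def by linarith
  then show ?case
    using Suc.IH[of m1] Suc.IH[of m2] unfolding g0 g1 by auto
qed simp

lemma gain_split:
  assumes "7 * 2 ^ Suc d \<le> m + 6"
  obtains m1 m2 where "m = m1 + m2 + 6" "7 * 2 ^ d \<le> m1 + 6" "7 * 2 ^ d \<le> m2 + 6"
    "2 * m1 \<le> m" "2 * m2 \<le> m"
    "gain (Suc d) m = m1 * m2 + 2 * m1 + m2 + 3 + gain d m1 + gain d m2"
proof
  let ?m1 = "(m - 6) div 2" let ?m2 = "m - 6 - ?m1"
  have "1 \<le> (2::nat) ^ d" by simp
  moreover have b: "14 * 2 ^ d \<le> m + 6" using assms by simp
  ultimately have "8 \<le> m" by linarith
  with b show "m = ?m1 + ?m2 + 6" "7 * 2 ^ d \<le> ?m1 + 6" "7 * 2 ^ d \<le> ?m2 + 6"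
    "2 * ?m1 \<le> m" "2 * ?m2 \<le> m" by linarith+
  show "gain (Suc d) m = ?m1 * ?m2 + 2 * ?m1 + ?m2 + 3 + gain d ?m1 + gain d ?m2"
    unfolding gain.simps Let_def ..
qed

text \<open>A crude bound suffices, as it is applied only to a block that is small compared with
  \<open>n\<close>.\<close>

lemma gain_upper: "7 * 2 ^ d \<le> m + 6 \<Longrightarrow> gain d m \<le> m * m"
proof (induction d arbitrary: m)
  case (Suc d)
  obtain m1 m2 where m: "m = m1 + m2 + 6" "7 * 2 ^ d \<le> m1 + 6" "7 * 2 ^ d \<le> m2 + 6"
    "gain (Suc d) m = m1 * m2 + 2 * m1 + m2 + 3 + gain d m1 + gain d m2"
    using gain_split[OF Suc.prems] by blast
  have "gain (Suc d) m \<le> m1 * m2 + 2 * m1 + m2 + 3 + m1 * m1 + m2 * m2"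
    using m(4) Suc.IH[OF m(2)] Suc.IH[OF m(3)] by linarith
  also have "\<dots> \<le> (m1 + m2 + 6) * (m1 + m2 + 6)" by (simp add: algebra_simps)
  finally show ?case unfolding m(1) .
qed simp

text \<open>In the square of \<open>m = m1 + m2 + 6\<close> the cross term is twice the number of
  chords between the halves, and the squares of the halves are left to the induction; they sum to at
  most half of \<open>m^2\<close>, which gives the error \<open>m^2 / 2^d\<close>. The six rewired
  vertices cost \<open>12 * m1 + 12 * m2 + 36\<close>, of which \<open>4 * m1 + 2 * m2 + 6\<close>
  is regained, so each level loses at most \<open>10 * m\<close>.\<close>

lemma gain_lower:
  "7 * 2 ^ d \<le> m + 6 \<Longrightarrow> (real m)\<^sup>2 - (real m)\<^sup>2 / 2 ^ d - 10 * real d * real m \<le> 2 * real (gain d m)"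
proof (induction d arbitrary: m)
  case (Suc d)
  obtain m1 m2 where m: "m = m1 + m2 + 6" "7 * 2 ^ d \<le> m1 + 6" "7 * 2 ^ d \<le> m2 + 6" "2 * m1 \<le> m" "2 * m2 \<le> m"
    "gain (Suc d) m = m1 * m2 + 2 * m1 + m2 + 3 + gain d m1 + gain d m2"
    using gain_split[OF Suc.prems] by blast
  define r s t where "r = real m" and "s = real m1" and "t = real m2"
  have rst: "r = s + t + 6" "0 \<le> s" "0 \<le> t" "2 * s \<le> r" "2 * t \<le> r"
    using m by (auto simp: r_def s_def t_def)
  have "s\<^sup>2 + t\<^sup>2 \<le> r\<^sup>2 / 2"
    using mult_mono[of "2 * s" r "2 * s" r] mult_mono[of "2 * t" r "2 * t" r] rst
    by (simp add: power2_eq_square)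
  then have "(s\<^sup>2 + t\<^sup>2) / 2 ^ d \<le> (r\<^sup>2 / 2) / 2 ^ d" by (rule divide_right_mono) simp
  then have sq: "s\<^sup>2 / 2 ^ d + t\<^sup>2 / 2 ^ d \<le> r\<^sup>2 / 2 ^ Suc d"
    by (simp add: add_divide_distrib)
  have lin: "10 * real d * s + 10 * real d * t \<le> 10 * real d * r"
    using rst by (simp add: distrib_left)
  have "2 * real (gain (Suc d) m) = 2 * s * t + 4 * s + 2 * t + 6 + 2 * real (gain d m1) + 2 * real (gain d m2)"
    unfolding m(6) by (simp add: s_def t_def)
  also have "\<dots> \<ge> 2 * s * t + 4 * s + 2 * t + 6 + (s\<^sup>2 - s\<^sup>2 / 2 ^ d - 10 * real d * s)
      + (t\<^sup>2 - t\<^sup>2 / 2 ^ d - 10 * real d * t)"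
    using Suc.IH[OF m(2)] Suc.IH[OF m(3)] by (simp add: s_def t_def)
  finally have "2 * s * t + 4 * s + 2 * t + 6 + s\<^sup>2 + t\<^sup>2 - r\<^sup>2 / 2 ^ Suc d - 10 * real d * r
      \<le> 2 * real (gain (Suc d) m)"
    using sq lin by linarith
  moreover have "r\<^sup>2 = 2 * s * t + s\<^sup>2 + t\<^sup>2 + 12 * s + 12 * t + 36"
    unfolding rst(1) by (simp add: power2_eq_square algebra_simps)
  moreover have "10 * real (Suc d) * r = 10 * real d * r + 10 * r"
    by (simp add: algebra_simps)
  ultimately have "r\<^sup>2 - r\<^sup>2 / 2 ^ Suc d - 10 * real (Suc d) * r \<le> 2 * real (gain (Suc d) m)"
    using rst(1-3) by linarith
  then show ?case by (simp only: r_def)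
qed simp

text \<open>For fixed \<open>a\<close> the parameter \<open>j\<close> runs from 1 to
  \<open>n - 6 - a\<close>. Passing to \<open>a + 1\<close> changes the product by
  \<open>n - 6 - 2 * a\<close> and raises \<open>gain\<close> by at most \<open>a\<close>, so the
  least size grows by at most the number of values of \<open>j\<close>, and no gap opens.\<close>

lemma sizes_covered:
  assumes "a0 \<le> a1" "a1 + 7 \<le> n"
    and "a0 * (n - 5 - a0) + gain d a0 + 4 \<le> t" "t \<le> a1 * (n - 5 - a1) + gain d a1 + 4"
  shows "\<exists>a j. a0 \<le> a \<and> 1 \<le> j \<and> a + j + 6 \<le> n \<and> t = a * (n - 5 - a) + gain d a + j + 3"
  using assms
proof (induction a1 rule: dec_induct)
  case base
  then show ?case by (intro exI[of _ a0] exI[of _ 1]) auto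
next
  case (step a)
  define w where "w = n - 6 - a"
  have w: "n - 5 - a = Suc w" "n - 5 - Suc a = w" "a + w + 6 = n" "1 \<le> w"
    using step.prems(1) by (auto simp: w_def)
  have jump: "Suc a * w + gain d (Suc a) \<le> a * Suc w + gain d a + w"
    using gain_Suc[of d a] by simp
  consider "t \<le> a * (n - 5 - a) + gain d a + 4"
    | "a * (n - 5 - a) + gain d a + 4 < t" "t < Suc a * (n - 5 - Suc a) + gain d (Suc a) + 4"
    | "t = Suc a * (n - 5 - Suc a) + gain d (Suc a) + 4"
    using step.prems(3) by linarith
  then show ?case
  proof cases
    case 1
    then show ?thesis using step.IH step.prems by auto
  next
    case 2
    then show ?thesis using jump w step.hyps
      by (intro exI[of _ a] exI[of _ "t - (a * (n - 5 - a) + gain d a + 3)"]) auto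
  next
    case 3
    then show ?thesis using step.prems step.hyps by (intro exI[of _ "Suc a"] exI[of _ 1]) auto
  qed
qed

lemma ln_2_ge: "1 / 2 \<le> ln (2::real)"
proof -
  have "ln (1 / 2 :: real) \<le> 1 / 2 - 1" by (rule ln_le_minus_one) simp
  then show ?thesis by (simp add: ln_div)
qed

theorem theorem1p3:
  shows "\<exists>C::real. C > 0 \<and> (\<exists>n0::nat. \<forall>n::nat. \<forall>t::nat.
     n > n0 \<and> n - 2 \<le> t \<and> real t \<le> (real n)^2 / 2 - C * real n * ln (real n)
     \<longrightarrow> (\<exists>B. nk_blocker n t B))"
proof (intro exI[of _ "120::real"] conjI exI[of _ "1000::nat"] allI impI)
  fix n t :: nat
  assume nt: "n > 1000 \<and> n - 2 \<le> t \<and> real t \<le> (real n)\<^sup>2 / 2 - 120 * real n * ln (real n)"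
  have covered: "\<exists>B. nk_blocker n t B"
    if asm: "1 \<le> a0" "7 * 2 ^ d \<le> a0 + 6" "a0 \<le> a1" "a1 + 7 \<le> n"
      "a0 * (n - 5 - a0) + gain d a0 + 4 \<le> t" "t \<le> a1 * (n - 5 - a1) + gain d a1 + 4" for a0 a1 d
  proof -
    obtain a j where aj: "a0 \<le> a" "1 \<le> j" "a + j + 6 \<le> n" "t = a * (n - 5 - a) + gain d a + j + 3"
      using sizes_covered[OF asm(3-6)] by blast
    then show ?thesis using nk_blocker_exists[of a j n d] asm(1,2) by auto
  qed
  define l where "l = n div 2"
  show "\<exists>B. nk_blocker n t B"
  proof (cases "t \<le> l * (n - 5 - l) + 4")
    case True
    \<comment> \<open>Without splitting, \<open>a = 1\<close> and \<open>j = 1\<close> give the size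
      \<open>n - 2\<close>, the lower end of the range.\<close>
    show ?thesis
      by (rule covered[of 1 0 l]) (use True nt in \<open>auto simp: l_def\<close>)
  next
    case False
    \<comment> \<open>This gives \<open>100 * 2 ^ D \<le> n < 200 * 2 ^ D\<close>: the depth is
      logarithmic, and the error \<open>n^2 / 2^D\<close> of \<open>gain_lower\<close> is linear in
      \<open>n\<close>.\<close>
    define D where "D = (LEAST D. n < 200 * 2 ^ D)"
    have "n < 2 ^ n" by (rule less_exp)
    then have "n < 200 * 2 ^ n" by linarith
    then have D1: "n < 200 * 2 ^ D" unfolding D_def by (rule LeastI)
    have "D \<noteq> 0" using D1 nt by (intro notI) simp
    then obtain D' where D': "D = Suc D'" by (cases D) auto
    then have "\<not> n < 200 * 2 ^ D'" using not_less_Least[of D' "\<lambda>D. n < 200 * 2 ^ D"] unfolding D_def by simp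
    then have D2: "100 * 2 ^ D \<le> n" using D' by simp
    \<comment> \<open>This is the least block size that admits depth \<open>D\<close>. It is at most
      7 percent of \<open>n\<close>, so the sizes reached at depth \<open>D\<close> start below the
      end of the range handled without splitting.\<close>
    define a0 where "a0 = 7 * 2 ^ D - (6::nat)"
    have "1 \<le> (2::nat) ^ D" by simp
    then have a0: "1 \<le> a0" "7 * 2 ^ D = a0 + 6" unfolding a0_def by linarith+
    then have a0n: "100 * a0 \<le> 7 * n" using D2 by linarith
    have "a0 * (n - 5 - a0) + gain D a0 + 4 \<le> t"
    proof -
      have "a0 * (n - 5 - a0) + gain D a0 \<le> a0 * (n - 5 - a0) + a0 * a0"
        using gain_upper[of D a0] a0 by simp
      also have "\<dots> = a0 * (n - 5)"
        using a0n nt by (simp add: add_mult_distrib2[symmetric])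
      also have "\<dots> \<le> l * (n - 5 - l)"
      proof -
        have "5 * a0 \<le> l" "n - 5 \<le> 5 * (n - 5 - l)" using a0n nt by (auto simp: l_def)
        then have "5 * (a0 * (n - 5)) \<le> l * (5 * (n - 5 - l))"
          using mult_le_mono[of "5 * a0" l "n - 5" "5 * (n - 5 - l)"] by simp
        then show ?thesis by simp
      qed
      finally show ?thesis using False by linarith
    qed
    \<comment> \<open>The block size \<open>n - 7\<close> is the largest one that leaves room for
      \<open>j = 1\<close>.\<close>
    moreover have "t \<le> (n - 7) * (n - 5 - (n - 7)) + gain D (n - 7) + 4"
    proof -
      define r where "r = real n"
      have r: "1000 < r" using nt by (simp add: r_def)
      have m: "real (n - 7) = r - 7" using nt by (simp add: r_def)
      have P: "0 < (2::real) ^ D" by simp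
      have "real n < real (200 * 2 ^ D)" using D1 by (simp only: of_nat_less_iff)
      then have rD: "r \<le> 200 * 2 ^ D" by (simp add: r_def)
      have "(r - 7)\<^sup>2 \<le> r * r" unfolding power2_eq_square by (rule mult_mono) (use r in auto)
      also have "\<dots> \<le> r * (200 * 2 ^ D)" by (rule mult_left_mono) (use r rD in auto)
      finally have e1: "(r - 7)\<^sup>2 / 2 ^ D \<le> 200 * r" using P by (simp add: field_simps)
      have "real (2 ^ D) \<le> real n" using D2 by (simp only: of_nat_le_iff)
      then have "(2::real) ^ D \<le> r" by (simp add: r_def)
      then have "ln (2 ^ D) \<le> ln r" using r P by (subst ln_le_cancel_iff) auto
      then have "real D * ln 2 \<le> ln r" by (simp add: ln_realpow)
      moreover have "real D * (1 / 2) \<le> real D * ln 2" by (rule mult_left_mono[OF ln_2_ge]) simp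
      ultimately have D: "real D \<le> 2 * ln r" by linarith
      have "real D * (r - 7) \<le> real D * r" by (rule mult_left_mono) auto
      also have "\<dots> \<le> (2 * ln r) * r" by (rule mult_right_mono[OF D]) (use r in simp)
      finally have "real D * (r - 7) \<le> 2 * (r * ln r)" by (simp only: mult.commute mult.assoc)
      moreover have "10 * real D * (r - 7) = 10 * (real D * (r - 7))" by simp
      ultimately have e2: "10 * real D * (r - 7) \<le> 20 * (r * ln r)" by linarith
      have "1 \<le> ln r"
        using ln_mono[of "exp 1" r] exp_le r by simp
      then have e3: "r \<le> r * ln r" using r by simp
      have "7 * 2 ^ D \<le> n - 7 + 6" using D2 nt by linarith
      then have "(r - 7)\<^sup>2 - (r - 7)\<^sup>2 / 2 ^ D - 10 * real D * (r - 7) \<le> 2 * real (gain D (n - 7))"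
        using gain_lower[of D "n - 7"] m by simp
      moreover have "(r - 7)\<^sup>2 = r\<^sup>2 - 14 * r + 49" by (simp add: power2_eq_square algebra_simps)
      moreover have "real t \<le> r\<^sup>2 / 2 - 120 * (r * ln r)" using nt by (simp add: r_def mult.assoc)
      \<comment> \<open>After doubling, the losses are at most \<open>14 * r\<close>,
        \<open>200 * r\<close> and \<open>20 * r * ln r\<close>. By \<open>e3\<close> they total at
        most \<open>234 * r * ln r\<close>, and twice the constant 120 exceeds 234.\<close>
      ultimately have "real t \<le> real (gain D (n - 7))" using e1 e2 e3 r by linarith
      then show ?thesis by simp
    qed
    ultimately show ?thesis
      by (rule covered[of a0 D "n - 7", rotated 4]) (use a0 a0n nt in auto)
  qed
qed simp

end
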